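(* Let $a,b\in\mathbb{R}$ with $a<b$ and let $n\in\mathbb{N}=\{1,2,\dots\}$. (A) For all $X,Y\in\mathcal{X}_{[a,b]}$, the following three statements are equivalent: (i) $X\ge_n^{[a,b]}Y$; (ii) $\mathbb{E}[u(X)]\ge\mathbb{E}[u(Y)]$ for all $u\in\mathcal{U}_n^{[a,b]}$; (iii) $\mathbb{E}[u(X)]\ge\mathbb{E}[u(Y)]$ for all $u\in\overline{\mathcal{U}}_n^{[a,b]}$. (B) For all $X,Y\in\mathcal{X}_{[a,b]}$, the following three statements are equivalent: (iv) $X\ge_n Y$; (v) $\mathbb{E}[u(X)]\ge\mathbb{E}[u(Y)]$ for all $u\in\mathcal{U}_n$; (vi) $\mathbb{E}[u(X)]\ge\mathbb{E}[u(Y)]$ for all $u\in\overline{\mathcal{U}}_n$. (C) For all $X,Y\in\mathcal{X}_{[a,b]}$, (i) implies (iv). (D) The implication (iv) $\Rightarrow$ (i) holds for all $X,Y\in\mathcal{X}_{[a,b]}$ if and only if $n\le 3$.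
   Context: $\mathcal{X}_{[a,b]}$ denotes the set of all bounded random variables taking values in $[a,b]$, and $\mathcal{X}$ the set of all bounded real random variables. All relations below depend only on the distributions, and every distribution supported in $[a,b]$ is the distribution of some element of $\mathcal{X}_{[a,b]}$. $F_X$ is the distribution function of $X$. Write $[n]=\{1,\dots,n\}$. For a distribution function $F$, put $F^{[1]}=F$ and $F^{[k]}(\eta)=\int_{-\infty}^{\eta}F^{[k-1]}(\xi)\,\mathrm{d}\xi$ for $\eta\in\mathbb{R}$, $k\ge 2$. (Thus $F_X^{[k+1]}(\eta)=\frac{1}{k!}\mathbb{E}[(\eta-X)_+^{k}]$ for $k\ge1$, where $x_+=\max\{0,x\}$.) $n$th-order stochastic dominance on $\mathbb{R}$: for $X,Y\in\mathcal{X}$, $X\ge_n Y$ means $F_X^{[n]}(\eta)\le F_Y^{[n]}(\eta)$ for all $\eta\in\mathbb{R}$. $n$th-order stochastic dominance on $[a,b]$: for $X,Y\in\mathcal{X}_{[a,b]}$, $X\ge_n^{[a,b]}Y$ means $F_X^{[n]}(\eta)\le F_Y^{[n]}(\eta)$ for all $\eta\in[a,b]$ and $F_X^{[k]}(b)\le F_Y^{[k]}(b)$ for all $k\in[n]$. Utility classes: $\mathcal{U}_n^{[a,b]}=\{u:\mathbb{R}\to\mathbb{R}\mid (-1)^{k-1}u^{(k)}\ge 0 \text{ on } [a,b] \text{ for all } k\in[n]\}$ and $\mathcal{U}_n=\{u:\mathbb{R}\to\mathbb{R}\mid (-1)^{k-1}u^{(k)}\ge 0 \text{ on } \mathbb{R}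 \text{ for all } k\in[n]\}$, where $u^{(k)}$ is the $k$th derivative, understood to exist (on $[a,b]$, resp. $\mathbb{R}$) whenever written. $\overline{\mathcal{U}}_n^{[a,b]}$ and $\overline{\mathcal{U}}_n$ are the closures of $\mathcal{U}_n^{[a,b]}$ and $\mathcal{U}_n$ with respect to pointwise convergence. *)

theory Defs
  imports "HOL-Probability.Probability"
begin

definition rv_in :: "'w measure \<Rightarrow> real \<Rightarrow> real \<Rightarrow> ('w \<Rightarrow> real) set" where
  "rv_in M a b = {X \<in> borel_measurable M. \<forall>\<omega>\<in>space M. X \<omega> \<in> {a..b}}"

text \<open>Indices start at \<open>1\<close>; the value at index \<open>0\<close> is arbitrary and never used.
  For the distribution function of a bounded random variable, every integrand below vanishes
  near \<open>-\<infinity>\<close> and is bounded on \<open>{..\<eta>}\<close>, so the Lebesgue integrals exist.\<close>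

fun iter_df :: "(real \<Rightarrow> real) \<Rightarrow> nat \<Rightarrow> real \<Rightarrow> real" where
  "iter_df F 0 = F"
| "iter_df F (Suc 0) = F"
| "iter_df F (Suc (Suc k)) = (\<lambda>\<eta>. LBINT \<xi>:{..\<eta>}. iter_df F (Suc k) \<xi>)"

definition iter_df_rv :: "'w measure \<Rightarrow> ('w \<Rightarrow> real) \<Rightarrow> nat \<Rightarrow> real \<Rightarrow> real" where
  "iter_df_rv M X k = iter_df (cdf (distr M borel X)) k"

definition sd :: "'w measure \<Rightarrow> nat \<Rightarrow> ('w \<Rightarrow> real) \<Rightarrow> ('w \<Rightarrow> real) \<Rightarrow> bool" where
  "sd M n X Y \<longleftrightarrow> (\<forall>\<eta>. iter_df_rv M X n \<eta> \<le> iter_df_rv M Y n \<eta>)"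

definition sd_on ::
  "'w measure \<Rightarrow> real \<Rightarrow> real \<Rightarrow> nat \<Rightarrow> ('w \<Rightarrow> real) \<Rightarrow> ('w \<Rightarrow> real) \<Rightarrow> bool" where
  "sd_on M a b n X Y \<longleftrightarrow>
     (\<forall>\<eta>\<in>{a..b}. iter_df_rv M X n \<eta> \<le> iter_df_rv M Y n \<eta>) \<and>
     (\<forall>k\<in>{1..n}. iter_df_rv M X k b \<le> iter_df_rv M Y k b)"

text \<open>The \<open>k\<close>th derivative on \<open>S\<close>, where \<open>S\<close> is a nondegenerate closed interval or \<open>UNIV\<close>;
  at an endpoint of an interval the derivatives are one-sided. Values outside \<open>S\<close> are
  irrelevant, and values on \<open>S\<close> are meaningful only if the derivatives exist, which is
  required separately in \<open>utilities\<close>.\<close>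

primrec kth_deriv :: "real set \<Rightarrow> (real \<Rightarrow> real) \<Rightarrow> nat \<Rightarrow> real \<Rightarrow> real" where
  "kth_deriv S u 0 = u"
| "kth_deriv S u (Suc k) = (\<lambda>x. vector_derivative (kth_deriv S u k) (at x within S))"

definition utilities :: "nat \<Rightarrow> real set \<Rightarrow> (real \<Rightarrow> real) set" where
  "utilities n S = {u. \<forall>k\<in>{1..n}. \<forall>x\<in>S.
     kth_deriv S u (k - 1) differentiable (at x within S) \<and>
     (-1) ^ (k - 1) * kth_deriv S u k x \<ge> 0}"

text \<open>On \<open>real \<Rightarrow> real\<close> the library topology is the product topology, i.e. the topology of
  pointwise convergence, so \<open>closure\<close> is the closure with respect to pointwise convergence.\<close>

definition closed_utilities :: "nat \<Rightarrow> real set \<Rightarrow> (real \<Rightarrow> real) set" where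
  "closed_utilities n S = closure (utilities n S)"

definition prefers ::
  "'w measure \<Rightarrow> (real \<Rightarrow> real) set \<Rightarrow> ('w \<Rightarrow> real) \<Rightarrow> ('w \<Rightarrow> real) \<Rightarrow> bool" where
  "prefers M U X Y \<longleftrightarrow>
     (\<forall>u\<in>U. prob_space.expectation M (\<lambda>\<omega>. u (X \<omega>)) \<ge> prob_space.expectation M (\<lambda>\<omega>. u (Y \<omega>)))"

end

theory Submission
  imports Defs "HOL-Computational_Algebra.Polynomial"
begin

text \<open>
  Throughout, \<open>n = m + 1\<close>. Fubini's theorem gives
  \<open>F\<^sub>X\<^bsup>[k+1]\<^esup>(\<eta>) = E[(\<eta> - X)\<^sub>+\<^sup>k] / k!\<close> (\<open>iter_df_rv_eq\<close>), so both dominance relations compare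
  expectations of explicit test functions: \<open>x \<mapsto> -(\<eta> - x)\<^sub>+\<^sup>m\<close> and, for dominance on
  \<open>[a, b]\<close>, also \<open>x \<mapsto> -(b - x)\<^sup>k\<close> with \<open>k \<le> m\<close>.

  \<^bold>\<open>Dominance on an interval implies preference.\<close> Every utility on \<open>[a, b]\<close> is, up to its value
  at \<open>b\<close>, a uniform limit of nonnegative combinations of these test functions
  (\<open>chain_approximation\<close>). For \<open>n = 1\<close> this is the approximation of a continuous increasing
  function by step functions. For the step from \<open>n\<close> to \<open>n + 1\<close>, the negated derivative of a
  utility of order \<open>n + 1\<close> is a utility of order \<open>n\<close>, and integrating over \<open>[x, b]\<close> raises the
  degree of each test function by one. The value of the negated derivative at \<open>b\<close>, which is
  nonpositive, contributes the test function of degree one. No regularity of the \<open>n\<close>th derivative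
  beyond its existence is needed.

  \<^bold>\<open>Preference implies dominance.\<close> The functions \<open>-(b - x)\<^sup>k\<close> are utilities on \<open>[a, b]\<close>. The
  functions \<open>-(\<eta> - x)\<^sub>+\<^sup>m\<close> are pointwise limits of rescaled second differences of
  \<open>-(\<eta> - x)\<^sub>+\<^bsup>m+2\<^esup>\<close> in \<open>\<eta>\<close>, which are utilities on the whole line
  (\<open>neg_tpow_in_closure\<close>).

  \<^bold>\<open>Passing to the closure.\<close> Utilities increase on \<open>[a, b]\<close>. A pointwise limit \<open>u\<close> of a net of
  increasing functions is already the limit of a sequence on a given countable set. If this set
  contains the rationals, the end points and the discontinuities of \<open>u\<close>, then the sequence
  converges on all of \<open>[a, b]\<close>, and dominated convergence applies (\<open>prefers_closure\<close>).

  \<^bold>\<open>The whole line.\<close> For \<open>\<eta> \<ge> b\<close> the difference \<open>F\<^sub>Y\<^bsup>[n]\<^esup> - F\<^sub>X\<^bsup>[n]\<^esup>\<close> is a polynomial in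
  \<open>\<eta>\<close> whose derivatives are the differences of lower order. A polynomial that is nonnegative near
  \<open>\<infinity>\<close> has a nonnegative leading coefficient, hence so have its derivatives. Thus dominance on
  the line yields dominance on \<open>[a, B]\<close> for some \<open>B \<ge> b\<close>, and the result for intervals applies
  with \<open>B\<close> in place of \<open>b\<close> (\<open>sd_iff_prefers\<close>).

  \<^bold>\<open>Comparison of the two relations.\<close> Utilities on the line are utilities on \<open>[a, b]\<close>, so dominance
  on the interval is the stronger relation. If \<open>n \<le> 3\<close>, the only boundary condition at \<open>b\<close>
  that is neither trivial nor part of dominance on the line is \<open>E[b - X] \<le> E[b - Y]\<close>, which does
  not depend on the point \<open>b\<close> and so may be checked at \<open>B\<close>. If \<open>n \<ge> 4\<close>, a pair of two-point
  distributions satisfies dominance of order \<open>4\<close> on the line, hence of all higher orders, but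
  violates \<open>E[(b - X)\<^sup>2] \<le> E[(b - Y)\<^sup>2]\<close> (\<open>ex_sd_4_not_second_moment_ordered\<close>).
\<close>

section \<open>Truncated powers and iterated distribution functions\<close>

text \<open>The truncated power \<open>s\<^sub>+\<^sup>k\<close>, where \<open>s\<^sub>+\<^sup>0\<close> is the indicator of \<open>s \<ge> 0\<close>. With this
  convention \<open>E[(\<eta> - X)\<^sub>+\<^sup>0]\<close> is the distribution function of \<open>X\<close> at \<open>\<eta>\<close>.\<close>

definition tpow :: "nat \<Rightarrow> real \<Rightarrow> real" where
  "tpow k s = (if 0 \<le> s then s ^ k else 0)"

lemma tpow_nonneg: "0 \<le> tpow k s"
  by (simp add: tpow_def)

lemma tpow_mono: "s \<le> t \<Longrightarrow> tpow k s \<le> tpow k t"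
  by (auto simp: tpow_def intro: power_mono)

lemma tpow_measurable [measurable]: "tpow k \<in> borel_measurable borel"
  unfolding tpow_def[abs_def] by measurable

lemma tpow_mult: "0 < c \<Longrightarrow> tpow k (c * s) = c ^ k * tpow k s"
  by (auto simp: tpow_def power_mult_distrib zero_le_mult_iff)

lemma nn_integral_tpow:
  "(\<integral>\<^sup>+\<xi>. ennreal (indicator {..\<eta>} \<xi> * tpow k (\<xi> - x)) \<partial>lborel) =
     ennreal (tpow (Suc k) (\<eta> - x) / real (Suc k))"
proof (cases "x \<le> \<eta>")
  case True
  have "(\<integral>\<^sup>+\<xi>. ennreal (indicator {..\<eta>} \<xi> * tpow k (\<xi> - x)) \<partial>lborel) =
      (\<integral>\<^sup>+\<xi>. ennreal ((\<xi> - x) ^ k) * indicator {x..\<eta>} \<xi> \<partial>lborel)"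
    by (intro nn_integral_cong) (auto simp: tpow_def indicator_def)
  also have "\<dots> = ennreal ((\<eta> - x) ^ Suc k / real (Suc k) - (x - x) ^ Suc k / real (Suc k))"
    using True
    by (intro nn_integral_FTC_Icc)
      (auto intro!: derivative_eq_intros simp: divide_simps simp del: power_Suc of_nat_Suc)
  finally show ?thesis using True by (simp add: tpow_def)
next
  case False
  have "(\<integral>\<^sup>+\<xi>. ennreal (indicator {..\<eta>} \<xi> * tpow k (\<xi> - x)) \<partial>lborel) = (\<integral>\<^sup>+\<xi>. 0 \<partial>(lborel :: real measure))"
    using False by (intro nn_integral_cong) (auto simp: tpow_def indicator_def)
  then show ?thesis using False by (simp add: tpow_def)
qed

lemma rv_inD:
  assumes "X \<in> rv_in M a b"
  shows "X \<in> borel_measurable M" "\<And>\<omega>. \<omega> \<in> space M \<Longrightarrow> a \<le> X \<omega>" "\<And>\<omega>. \<omega> \<in> space M \<Longrightarrow> X \<omega> \<le> b"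
  using assms by (auto simp: rv_in_def)

context prob_space
begin

lemma integrable_comp_bounded:
  assumes "X \<in> rv_in M a b" "f \<in> borel_measurable borel"
    and "\<And>x. x \<in> {a..b} \<Longrightarrow> \<bar>f x\<bar> \<le> (B::real)"
  shows "integrable M (\<lambda>\<omega>. f (X \<omega>) :: real)"
  using assms rv_inD[OF assms(1)]
  by (intro integrable_const_bound[of _ B]) (auto intro!: AE_I2)

lemma integrable_tpow:
  assumes "X \<in> rv_in M a b"
  shows "integrable M (\<lambda>\<omega>. tpow k (\<eta> - X \<omega>))"
  by (rule integrable_comp_bounded[OF assms, where f = "\<lambda>x. tpow k (\<eta> - x)" and B = "tpow k (\<eta> - a)"])
    (auto simp: tpow_nonneg intro!: tpow_mono)

lemma integrable_power:
  assumes "X \<in> rv_in M a b"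
  shows "integrable M (\<lambda>\<omega>. (c - X \<omega>) ^ k)"
proof (rule integrable_comp_bounded[OF assms, where f = "\<lambda>x. (c - x) ^ k"])
  fix x assume "x \<in> {a..b}"
  then have "\<bar>c - x\<bar> \<le> \<bar>c - a\<bar> + \<bar>c - b\<bar>" by auto
  then show "\<bar>(c - x) ^ k\<bar> \<le> (\<bar>c - a\<bar> + \<bar>c - b\<bar>) ^ k"
    by (simp add: power_abs power_mono)
qed simp

lemma iter_df_rv_eq:
  assumes X: "X \<in> rv_in M a b"
  shows "iter_df_rv M X (Suc k) \<eta> = expectation (\<lambda>\<omega>. tpow k (\<eta> - X \<omega>)) / fact k"
proof (induction k arbitrary: \<eta>)
  case 0
  have [measurable]: "X \<in> borel_measurable M" using rv_inD[OF X] by auto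
  have "iter_df_rv M X (Suc 0) \<eta> = prob (X -` {..\<eta>} \<inter> space M)"
    by (simp add: iter_df_rv_def cdf_def measure_distr)
  also have "\<dots> = expectation (indicator (X -` {..\<eta>} \<inter> space M))"
    by simp
  also have "\<dots> = expectation (\<lambda>\<omega>. tpow 0 (\<eta> - X \<omega>))"
    by (intro Bochner_Integration.integral_cong) (auto simp: tpow_def indicator_def)
  finally show ?case by simp
next
  case (Suc k)
  have [measurable]: "X \<in> borel_measurable M" using rv_inD[OF X] by auto
  interpret L: pair_sigma_finite lborel M ..
  let ?E = "\<lambda>\<xi>. expectation (\<lambda>\<omega>. tpow k (\<xi> - X \<omega>)) / fact k"
  let ?V = "expectation (\<lambda>\<omega>. tpow (Suc k) (\<eta> - X \<omega>)) / fact (Suc k)"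
  have V0: "0 \<le> ?V" by (simp add: tpow_nonneg)
  have [measurable]: "?E \<in> borel_measurable borel" by measurable
  have E: "iter_df_rv M X (Suc k) = ?E"
    using Suc.IH by blast
  have "(\<integral>\<^sup>+\<xi>. ennreal (indicator {..\<eta>} \<xi> * ?E \<xi>) \<partial>lborel) =
      (\<integral>\<^sup>+\<xi>. (\<integral>\<^sup>+\<omega>. ennreal (indicator {..\<eta>} \<xi> * tpow k (\<xi> - X \<omega>)) / fact k \<partial>M) \<partial>lborel)"
  proof (rule nn_integral_cong)
    fix \<xi> :: real
    have "ennreal (?E \<xi>) = ennreal (expectation (\<lambda>\<omega>. tpow k (\<xi> - X \<omega>) / fact k))"
      by simp
    also have "\<dots> = (\<integral>\<^sup>+\<omega>. ennreal (tpow k (\<xi> - X \<omega>) / fact k) \<partial>M)"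
      using integrable_tpow[OF X] by (intro nn_integral_eq_integral[symmetric]) (auto simp: tpow_nonneg)
    also have "\<dots> = (\<integral>\<^sup>+\<omega>. ennreal (tpow k (\<xi> - X \<omega>)) / fact k \<partial>M)"
      by (intro nn_integral_cong) (metis divide_ennreal ennreal_fact fact_gt_zero tpow_nonneg)
    finally show "ennreal (indicator {..\<eta>} \<xi> * ?E \<xi>) =
        (\<integral>\<^sup>+\<omega>. ennreal (indicator {..\<eta>} \<xi> * tpow k (\<xi> - X \<omega>)) / fact k \<partial>M)"
      by (auto simp: indicator_def)
  qed
  also have "\<dots> = (\<integral>\<^sup>+\<omega>. (\<integral>\<^sup>+\<xi>. ennreal (indicator {..\<eta>} \<xi> * tpow k (\<xi> - X \<omega>)) / fact k \<partial>lborel) \<partial>M)"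
    by (intro L.Fubini'[symmetric]) measurable
  also have "\<dots> = (\<integral>\<^sup>+\<omega>. ennreal (tpow (Suc k) (\<eta> - X \<omega>) / fact (Suc k)) \<partial>M)"
  proof (rule nn_integral_cong)
    fix \<omega>
    have "(\<integral>\<^sup>+\<xi>. ennreal (indicator {..\<eta>} \<xi> * tpow k (\<xi> - X \<omega>)) / fact k \<partial>lborel) =
      ennreal (tpow (Suc k) (\<eta> - X \<omega>) / real (Suc k)) / fact k"
      by (subst nn_integral_divide) (simp_all add: nn_integral_tpow)
    also have "\<dots> = ennreal (tpow (Suc k) (\<eta> - X \<omega>) / real (Suc k)) / ennreal (fact k)"
      by (simp add: ennreal_fact)
    also have "\<dots> = ennreal (tpow (Suc k) (\<eta> - X \<omega>) / fact (Suc k))"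
      by (subst divide_ennreal) (auto simp: tpow_nonneg field_simps)
    finally show "(\<integral>\<^sup>+\<xi>. ennreal (indicator {..\<eta>} \<xi> * tpow k (\<xi> - X \<omega>)) / fact k \<partial>lborel) =
      ennreal (tpow (Suc k) (\<eta> - X \<omega>) / fact (Suc k))" .
  qed
  also have "\<dots> = ennreal (expectation (\<lambda>\<omega>. tpow (Suc k) (\<eta> - X \<omega>) / fact (Suc k)))"
    using integrable_tpow[OF X] by (intro nn_integral_eq_integral) (auto simp: tpow_nonneg)
  finally have *: "(\<integral>\<^sup>+\<xi>. ennreal (indicator {..\<eta>} \<xi> * ?E \<xi>) \<partial>lborel) = ennreal ?V"
    by simp
  have "iter_df_rv M X (Suc (Suc k)) \<eta> = (LBINT \<xi>:{..\<eta>}. iter_df_rv M X (Suc k) \<xi>)"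
    by (simp add: iter_df_rv_def)
  also have "\<dots> = (\<integral>\<xi>. indicator {..\<eta>} \<xi> * ?E \<xi> \<partial>lborel)"
    by (simp only: E set_lebesgue_integral_def real_scaleR_def)
  also have "\<dots> = ?V"
    using * V0 by (subst integral_eq_nn_integral) (auto simp: tpow_nonneg)
  finally show ?case .
qed

lemma iter_df_rv_le_iff:
  assumes "X \<in> rv_in M a b" "Y \<in> rv_in M a b"
  shows "iter_df_rv M X (Suc k) \<eta> \<le> iter_df_rv M Y (Suc k) \<eta> \<longleftrightarrow>
    expectation (\<lambda>\<omega>. tpow k (\<eta> - X \<omega>)) \<le> expectation (\<lambda>\<omega>. tpow k (\<eta> - Y \<omega>))"
  by (simp add: iter_df_rv_eq[OF assms(1)] iter_df_rv_eq[OF assms(2)] divide_le_cancel)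

end

section \<open>Utilities as chains of derivatives\<close>

text \<open>The functions \<open>d 0, \<dots>, d n\<close> are successive derivatives on \<open>S\<close>, one-sided at end points of
  \<open>S\<close>, and \<open>d 1, \<dots>, d n\<close> have the alternating signs required of utilities. The members of
  \<open>utilities n S\<close> are exactly the functions \<open>d 0\<close>, provided that no point of \<open>S\<close> is isolated
  in \<open>S\<close>.\<close>

definition deriv_chain :: "nat \<Rightarrow> real set \<Rightarrow> (nat \<Rightarrow> real \<Rightarrow> real) \<Rightarrow> bool" where
  "deriv_chain n S d \<longleftrightarrow> (\<forall>k<n. \<forall>x\<in>S.
     (d k has_real_derivative d (Suc k) x) (at x within S) \<and> 0 \<le> (-1) ^ k * d (Suc k) x)"

lemma kth_deriv_eq_chain:
  assumes S: "\<And>x. x \<in> S \<Longrightarrow> at x within S \<noteq> bot"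
    and d: "\<And>k x. k < n \<Longrightarrow> x \<in> S \<Longrightarrow> (d k has_real_derivative d (Suc k) x) (at x within S)"
  shows "k \<le> n \<Longrightarrow> x \<in> S \<Longrightarrow> kth_deriv S (d 0) k x = d k x"
proof (induction k arbitrary: x)
  case (Suc k)
  have "(d k has_vector_derivative d (Suc k) x) (at x within S)"
    using d Suc.prems by (simp add: has_real_derivative_iff_has_vector_derivative)
  then have "(kth_deriv S (d 0) k has_vector_derivative d (Suc k) x) (at x within S)"
    by (rule has_vector_derivative_transform[rotated 2]) (use Suc in auto)
  then show ?case
    using S Suc.prems by (simp add: vector_derivative_within)
qed simp

lemma chain_in_utilities:
  assumes S: "\<And>x. x \<in> S \<Longrightarrow> at x within S \<noteq> bot" and d: "deriv_chain n S d"
  shows "d 0 \<in> utilities n S"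
proof -
  have D: "(d k has_real_derivative d (Suc k) x) (at x within S)" if "k < n" "x \<in> S" for k x
    using d that by (auto simp: deriv_chain_def)
  have eq: "kth_deriv S (d 0) k x = d k x" if "k \<le> n" "x \<in> S" for k x
    using kth_deriv_eq_chain[of S n d k x] S D that by blast
  show ?thesis
    unfolding utilities_def
  proof (intro CollectI ballI conjI)
    fix k x assume k: "k \<in> {1..n}" and x: "x \<in> S"
    then obtain j where j: "k = Suc j" "j < n" by (cases k) auto
    have "(d j has_vector_derivative d (Suc j) x) (at x within S)"
      using D[OF j(2) x] by (simp add: has_real_derivative_iff_has_vector_derivative)
    then have "(kth_deriv S (d 0) j has_vector_derivative d (Suc j) x) (at x within S)"
      by (rule has_vector_derivative_transform[rotated 2]) (use eq j x in auto)
    then show "kth_deriv S (d 0) (k - 1) differentiable (at x within S)"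
      using j by (auto intro: differentiableI_vector)
    show "0 \<le> (- 1) ^ (k - 1) * kth_deriv S (d 0) k x"
      using d j x eq[of k x] by (auto simp: deriv_chain_def)
  qed
qed

lemma utilities_chain:
  assumes "u \<in> utilities n S"
  obtains d where "d 0 = u" "deriv_chain n S d"
proof
  show "kth_deriv S u 0 = u" by simp
  show "deriv_chain n S (kth_deriv S u)"
    unfolding deriv_chain_def
  proof (intro allI impI ballI)
    fix k x assume k: "k < n" and x: "x \<in> S"
    then have "Suc k \<in> {1..n}" by auto
    with assms x have "kth_deriv S u (Suc k - 1) differentiable (at x within S) \<and>
       0 \<le> (-1) ^ (Suc k - 1) * kth_deriv S u (Suc k) x"
      unfolding utilities_def by blast
    then show "(kth_deriv S u k has_real_derivative kth_deriv S u (Suc k) x) (at x within S) \<and>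
       0 \<le> (-1) ^ k * kth_deriv S u (Suc k) x"
      by (simp add: has_real_derivative_iff_has_vector_derivative vector_derivative_works)
  qed
qed

lemma deriv_chain_mono:
  assumes "deriv_chain n S d" "T \<subseteq> S" "m \<le> n"
  shows "deriv_chain m T d"
  using assms unfolding deriv_chain_def by (meson DERIV_subset order_less_le_trans subsetD)

lemma at_within_Icc_neq_bot: "a < b \<Longrightarrow> x \<in> {a..b} \<Longrightarrow> at x within {a..b} \<noteq> bot" for x :: real
  by (simp add: trivial_limit_within islimpt_Icc)

lemma utilities_restrict:
  assumes "a < b"
  shows "utilities n UNIV \<subseteq> utilities n {a..b}"
proof
  fix u assume "u \<in> utilities n UNIV"
  then obtain d where "d 0 = u" "deriv_chain n UNIV d" by (rule utilities_chain)
  then show "u \<in> utilities n {a..b}"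
    using chain_in_utilities[of "{a..b}" n d] at_within_Icc_neq_bot[OF assms]
      deriv_chain_mono[of n UNIV d "{a..b}" n] by auto
qed

lemma chain_mono_on:
  assumes d: "deriv_chain n {a..b} d" and n: "1 \<le> n"
  shows "mono_on {a..b} (d 0)"
proof (rule mono_onI)
  fix x y assume xy: "x \<in> {a..b}" "y \<in> {a..b}" "x \<le> y"
  have D: "(d 0 has_real_derivative d 1 z) (at z within {a..b})" "0 \<le> d 1 z" if "z \<in> {a..b}" for z
  proof -
    have "(d 0 has_real_derivative d (Suc 0) z) (at z within {a..b}) \<and> 0 \<le> (-1) ^ 0 * d (Suc 0) z"
      using d n that unfolding deriv_chain_def by auto
    then show "(d 0 has_real_derivative d 1 z) (at z within {a..b})" "0 \<le> d 1 z" by auto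
  qed
  show "d 0 x \<le> d 0 y"
  proof (rule DERIV_nonneg_imp_increasing_open[OF xy(3)])
    fix z assume z: "x < z" "z < y"
    then have "z \<in> {a..b}" "z \<in> interior {a..b}" using xy by auto
    then show "\<exists>l. (d 0 has_real_derivative l) (at z) \<and> 0 \<le> l"
      using D[of z] at_within_interior[of z "{a..b}"] by auto
  next
    have "continuous_on {a..b} (d 0)"
      by (rule DERIV_continuous_on) (rule D(1))
    then show "continuous_on {x..y} (d 0)"
      by (rule continuous_on_subset) (use xy in auto)
  qed
qed

lemma utilities_mono_on:
  assumes "u \<in> utilities n S" "{a..b} \<subseteq> S" "1 \<le> n"
  shows "mono_on {a..b} u"
  using assms by (metis chain_mono_on deriv_chain_mono order_refl utilities_chain)

section \<open>Pointwise closures\<close>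

text \<open>The product topology is not first countable, but on countably many coordinates a point of the
  closure is still the limit of a sequence.\<close>

lemma closure_pointwise_sequence:
  fixes u :: "'a \<Rightarrow> real"
  assumes u: "u \<in> closure A" and Q: "countable Q"
  shows "\<exists>v. (\<forall>i::nat. v i \<in> A) \<and> (\<forall>q\<in>Q. (\<lambda>i. v i q) \<longlonglongrightarrow> u q)"
proof -
  let ?q = "from_nat_into Q"
  have "\<exists>v\<in>A. \<forall>j\<in>{..i}. v (?q j) \<in> ball (u (?q j)) (inverse (Suc i))" for i :: nat
  proof -
    have "open {f. \<forall>j\<in>{..i}. f (?q j) \<in> ball (u (?q j)) (inverse (Suc i))}"
      by (rule product_topology_basis') auto
    moreover have "u \<in> {f. \<forall>j\<in>{..i}. f (?q j) \<in> ball (u (?q j)) (inverse (Suc i))}"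
      by (simp del: of_nat_Suc)
    ultimately have "A \<inter> {f. \<forall>j\<in>{..i}. f (?q j) \<in> ball (u (?q j)) (inverse (Suc i))} \<noteq> {}"
      using u by (meson closure_iff_nhds_not_empty order_refl)
    then show ?thesis by blast
  qed
  then obtain v where v: "\<And>i::nat. v i \<in> A"
    "\<And>i j. j \<le> i \<Longrightarrow> v i (?q j) \<in> ball (u (?q j)) (inverse (Suc i))"
    by (metis atMost_iff)
  show ?thesis
  proof (intro exI conjI allI ballI)
    show "v i \<in> A" for i by (rule v)
    fix q assume "q \<in> Q"
    then obtain j where j: "q = ?q j" using Q by (metis from_nat_into_to_nat_on)
    have "(\<lambda>i. v i q - u q) \<longlonglongrightarrow> 0"
    proof (rule Lim_null_comparison[OF _ LIMSEQ_inverse_real_of_nat])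
      show "\<forall>\<^sub>F i in sequentially. norm (v i q - u q) \<le> inverse (real (Suc i))"
        using eventually_ge_at_top[of j]
        by eventually_elim (use v(2) j in \<open>fastforce simp: dist_real_def\<close>)
    qed
    then show "(\<lambda>i. v i q) \<longlonglongrightarrow> u q" by (simp add: LIM_zero_iff)
  qed
qed

lemma closure_pointwise_limit:
  fixes u :: "'a \<Rightarrow> real"
  assumes "\<And>i::nat. v i \<in> A" "\<And>x. (\<lambda>i. v i x) \<longlonglongrightarrow> u x"
  shows "u \<in> closure A"
proof -
  have "limitin (product_topology (\<lambda>_. euclidean) UNIV) v u sequentially"
    using assms(2) by (auto simp: limitin_componentwise)
  then have "v \<longlonglongrightarrow> u"
    by (simp add: euclidean_product_topology)
  moreover have "\<forall>\<^sub>F i in sequentially. v i \<in> closure A"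
    using assms(1) closure_subset by (auto intro!: always_eventually)
  ultimately show ?thesis
    by (intro Lim_in_closed_set[of "closure A" v sequentially u]) auto
qed

lemma mono_on_limit_at_continuity:
  fixes u :: "real \<Rightarrow> real"
  assumes v: "\<And>i::nat. mono_on {a..b} (v i)"
    and lim: "\<And>q. q \<in> \<rat> \<inter> {a..b} \<Longrightarrow> (\<lambda>i. v i q) \<longlonglongrightarrow> u q"
    and x: "a < x" "x < b" and cont: "continuous (at x within {a..b}) u"
  shows "(\<lambda>i. v i x) \<longlonglongrightarrow> u x"
proof (rule LIMSEQ_I)
  fix r :: real assume "0 < r"
  then have r: "0 < r / 2" by simp
  obtain \<delta> where \<delta>: "0 < \<delta>" "\<And>y. y \<in> {a..b} \<Longrightarrow> \<bar>y - x\<bar> < \<delta> \<Longrightarrow> \<bar>u y - u x\<bar> < r / 2"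
    using cont r unfolding continuous_within_eps_delta dist_real_def by meson
  obtain p where p: "p \<in> \<rat>" "max a (x - \<delta>) < p" "p < x"
    using Rats_dense_in_real[of "max a (x - \<delta>)" x] x \<delta>(1) by auto
  obtain q where q: "q \<in> \<rat>" "x < q" "q < min b (x + \<delta>)"
    using Rats_dense_in_real[of x "min b (x + \<delta>)"] x \<delta>(1) by auto
  have pq: "\<bar>u p - u x\<bar> < r / 2" "\<bar>u q - u x\<bar> < r / 2"
    using \<delta>(2)[of p] \<delta>(2)[of q] p q x by auto
  obtain N1 where N1: "\<And>i. N1 \<le> i \<Longrightarrow> \<bar>v i p - u p\<bar> < r / 2"
    using LIMSEQ_D[OF lim[of p] r] p x by auto
  obtain N2 where N2: "\<And>i. N2 \<le> i \<Longrightarrow> \<bar>v i q - u q\<bar> < r / 2"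
    using LIMSEQ_D[OF lim[of q] r] q x by auto
  show "\<exists>N. \<forall>i\<ge>N. norm (v i x - u x) < r"
  proof (intro exI allI impI)
    fix i assume i: "max N1 N2 \<le> i"
    have "v i p \<le> v i x" "v i x \<le> v i q"
      using p q x by (auto intro!: mono_onD[OF v[of i]])
    then show "norm (v i x - u x) < r"
      using N1[of i] N2[of i] pq i by (simp add: abs_less_iff del: less_divide_eq_numeral1)
  qed
qed

lemma measurable_mono_comp:
  assumes "mono_on {a..b} u" "X \<in> rv_in M a b"
  shows "(\<lambda>\<omega>. u (X \<omega>) :: real) \<in> borel_measurable M"
proof -
  have "X \<in> measurable M (restrict_space borel {a..b})"
    using rv_inD[OF assms(2)] by (intro measurable_restrict_space2) auto
  from measurable_compose[OF this borel_measurable_mono_on_fnc[OF assms(1)]] show ?thesis .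
qed

context prob_space
begin

lemma integrable_mono_comp:
  assumes u: "mono_on {a..b} u" and X: "X \<in> rv_in M a b"
  shows "integrable M (\<lambda>\<omega>. u (X \<omega>) :: real)"
proof (rule integrable_const_bound[where B = "\<bar>u a\<bar> + \<bar>u b\<bar>"])
  show "AE \<omega> in M. norm (u (X \<omega>)) \<le> \<bar>u a\<bar> + \<bar>u b\<bar>"
  proof (rule AE_I2)
    fix \<omega> assume "\<omega> \<in> space M"
    then have "u a \<le> u (X \<omega>)" "u (X \<omega>) \<le> u b"
      using rv_inD(2,3)[OF X, of \<omega>] by (auto intro!: mono_onD[OF u])
    then show "norm (u (X \<omega>)) \<le> \<bar>u a\<bar> + \<bar>u b\<bar>" by auto
  qed
qed (rule measurable_mono_comp[OF u X])

lemma expectation_mono_limit: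
  assumes X: "X \<in> rv_in M a b" and ab: "a \<le> b"
    and v: "\<And>i::nat. mono_on {a..b} (v i)"
    and lim: "\<And>x. x \<in> {a..b} \<Longrightarrow> (\<lambda>i. v i x) \<longlonglongrightarrow> (u x :: real)"
  shows "(\<lambda>i. expectation (\<lambda>\<omega>. v i (X \<omega>))) \<longlonglongrightarrow> expectation (\<lambda>\<omega>. u (X \<omega>))"
proof -
  have u: "mono_on {a..b} u"
  proof (rule mono_onI)
    fix x y assume xy: "x \<in> {a..b}" "y \<in> {a..b}" "x \<le> y"
    show "u x \<le> u y"
      using lim[OF xy(1)] lim[OF xy(2)] by (rule LIMSEQ_le) (use v xy in \<open>auto simp: mono_on_def\<close>)
  qed
  have "Bseq (\<lambda>i. v i a)" "Bseq (\<lambda>i. v i b)"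
    using lim[of a] lim[of b] ab by (auto intro!: convergent_imp_Bseq simp: convergent_def)
  then obtain K L where KL: "\<And>i. \<bar>v i a\<bar> \<le> K" "\<And>i. \<bar>v i b\<bar> \<le> L"
    by (metis BseqE real_norm_def)
  show ?thesis
  proof (rule integral_dominated_convergence[where w = "\<lambda>_. K + L"])
    show "(\<lambda>\<omega>. u (X \<omega>)) \<in> borel_measurable M" by (rule measurable_mono_comp[OF u X])
    show "(\<lambda>\<omega>. v i (X \<omega>)) \<in> borel_measurable M" for i by (rule measurable_mono_comp[OF v X])
    show "AE \<omega> in M. (\<lambda>i. v i (X \<omega>)) \<longlonglongrightarrow> u (X \<omega>)"
      using rv_inD[OF X] by (intro AE_I2 lim) auto
    show "AE \<omega> in M. norm (v i (X \<omega>)) \<le> K + L" for i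
    proof (rule AE_I2)
      fix \<omega> assume "\<omega> \<in> space M"
      then have "v i a \<le> v i (X \<omega>)" "v i (X \<omega>) \<le> v i b"
        using rv_inD(2,3)[OF X, of \<omega>] by (auto intro!: mono_onD[OF v])
      then show "norm (v i (X \<omega>)) \<le> K + L" using KL[of i] by auto
    qed
  qed simp
qed

lemma prefers_closure:
  assumes X: "X \<in> rv_in M a b" and Y: "Y \<in> rv_in M a b" and ab: "a \<le> b"
    and mono: "\<And>u. u \<in> A \<Longrightarrow> mono_on {a..b} u"
    and A: "prefers M A X Y"
  shows "prefers M (closure A) X Y"
  unfolding prefers_def
proof
  fix u assume u: "u \<in> closure A"
  have u_mono: "mono_on {a..b} u"
  proof (rule mono_onI)
    fix x y assume xy: "x \<in> {a..b}" "y \<in> {a..b}" "x \<le> y"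
    obtain v where v: "\<And>i::nat. v i \<in> A" "\<And>q. q \<in> {x, y} \<Longrightarrow> (\<lambda>i. v i q) \<longlonglongrightarrow> u q"
      using closure_pointwise_sequence[OF u, of "{x, y}"] by blast
    show "u x \<le> u y"
      using v(2)[of x] v(2)[of y]
      by (rule LIMSEQ_le) (use mono[OF v(1)] xy in \<open>auto simp: mono_on_def\<close>)
  qed
  let ?C = "{x \<in> {a..b}. \<not> continuous (at x within {a..b}) u}"
  have Q: "countable (\<rat> \<union> {a, b} \<union> ?C)"
    using mono_on_ctble_discont[OF u_mono] countable_rat by auto
  obtain v where v: "\<And>i::nat. v i \<in> A"
    and lim: "\<And>q. q \<in> \<rat> \<union> {a, b} \<union> ?C \<Longrightarrow> (\<lambda>i. v i q) \<longlonglongrightarrow> u q"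
    using closure_pointwise_sequence[OF u Q] by blast
  have vm: "mono_on {a..b} (v i)" for i using mono v by blast
  have L: "(\<lambda>i. v i x) \<longlonglongrightarrow> u x" if x: "x \<in> {a..b}" for x
  proof (cases "x \<in> {a, b} \<union> ?C")
    case False
    with x have *: "a < x" "x < b" "continuous (at x within {a..b}) u" by auto
    have "(\<lambda>i. v i q) \<longlonglongrightarrow> u q" if "q \<in> \<rat> \<inter> {a..b}" for q
      using that by (intro lim) blast
    from mono_on_limit_at_continuity[OF vm this *] show ?thesis .
  next
    case True
    then show ?thesis by (intro lim) blast
  qed
  show "expectation (\<lambda>\<omega>. u (Y \<omega>)) \<le> expectation (\<lambda>\<omega>. u (X \<omega>))"
    by (rule LIMSEQ_le[OF expectation_mono_limit[OF Y ab vm L] expectation_mono_limit[OF X ab vm L]])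
      (use A v in \<open>auto simp: prefers_def\<close>)
qed

end

section \<open>Uniform approximation of utilities by test functions\<close>

lemma tpow_Suc_eq_max: "tpow (Suc k) s = max 0 s ^ Suc k"
  by (simp add: tpow_def max_def)

lemma continuous_on_tpow_Suc [continuous_intros]:
  "continuous_on A f \<Longrightarrow> continuous_on A (\<lambda>x. tpow (Suc k) (f x))"
  unfolding tpow_Suc_eq_max by (intro continuous_intros)

lemma has_real_derivative_tpow:
  assumes "s \<noteq> 0 \<or> 0 < k"
  shows "(tpow (Suc k) has_real_derivative real (Suc k) * tpow k s) (at s)"
proof -
  consider "s < 0" | "0 < s" | "s = 0" "0 < k" using assms by linarith
  then show ?thesis
  proof cases
    case 1
    have "((\<lambda>_. 0) has_real_derivative 0) (at s)" by simp
    then have "(tpow (Suc k) has_real_derivative 0) (at s)"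
      by (rule has_field_derivative_transform_within_open[where S = "{..<0}"])
        (use 1 in \<open>auto simp: tpow_def\<close>)
    with 1 show ?thesis by (simp add: tpow_def)
  next
    case 2
    have "((\<lambda>t. t ^ Suc k) has_real_derivative real (Suc k) * s ^ k) (at s)"
      by (auto intro!: derivative_eq_intros simp del: power_Suc)
    then have "(tpow (Suc k) has_real_derivative real (Suc k) * s ^ k) (at s)"
      by (rule has_field_derivative_transform_within_open[where S = "{0<..}"])
        (use 2 in \<open>auto simp: tpow_def\<close>)
    with 2 show ?thesis by (simp add: tpow_def)
  next
    case 3
    have "((\<lambda>h. \<bar>h\<bar> ^ k) \<longlongrightarrow> \<bar>0\<bar> ^ k) (at (0::real))"
      by (intro tendsto_intros)
    moreover have "\<bar>0::real\<bar> ^ k = 0" using 3 by simp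
    ultimately have lim: "((\<lambda>h. \<bar>h\<bar> ^ k) \<longlongrightarrow> 0) (at (0::real))" by (simp only:)
    have "((\<lambda>h. (tpow (Suc k) (0 + h) - tpow (Suc k) 0) / h) \<longlongrightarrow> 0) (at 0)"
      by (rule Lim_null_comparison[OF _ lim]) (auto simp: tpow_def)
    moreover have "real (Suc k) * tpow k s = 0" using 3 by (simp add: tpow_def)
    ultimately show ?thesis unfolding DERIV_def using 3(1) by (simp only:)
  qed
qed

text \<open>The cone spanned by the test functions of dominance of order \<open>m + 1\<close> on \<open>[a, b]\<close>. Constants
  and the knot \<open>\<eta> = b\<close> are left out, so that all members vanish at \<open>b\<close>. For \<open>m > 0\<close> the knot
  \<open>b\<close> is covered on \<open>[a, b]\<close> by the boundary function with \<open>k = m\<close>, and for \<open>m = 0\<close> it would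
  give a constant.\<close>

inductive_set test_cone :: "real \<Rightarrow> real \<Rightarrow> nat \<Rightarrow> (real \<Rightarrow> real) set"
  for a b :: real and m :: nat where
  zero: "(\<lambda>x. 0) \<in> test_cone a b m"
| boundary: "k \<in> {1..m} \<Longrightarrow> (\<lambda>x. - ((b - x) ^ k)) \<in> test_cone a b m"
| knot: "\<eta> \<in> {a..<b} \<Longrightarrow> (\<lambda>x. - tpow m (\<eta> - x)) \<in> test_cone a b m"
| scale: "w \<in> test_cone a b m \<Longrightarrow> 0 \<le> c \<Longrightarrow> (\<lambda>x. c * w x) \<in> test_cone a b m"
| add: "v \<in> test_cone a b m \<Longrightarrow> w \<in> test_cone a b m \<Longrightarrow> (\<lambda>x. v x + w x) \<in> test_cone a b m"

lemma test_cone_sum: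
  "(\<And>i. i \<in> I \<Longrightarrow> f i \<in> test_cone a b m) \<Longrightarrow> (\<lambda>x. \<Sum>i\<in>I. f i x) \<in> test_cone a b m"
  by (induction I rule: infinite_finite_induct) (auto intro: test_cone.zero test_cone.add)

text \<open>The operator \<open>w \<mapsto> (x \<mapsto> \<integral>\<^bsub>[x, b]\<^esub> w)\<close> maps each cone into the next one.\<close>

lemma test_cone_integral:
  assumes "w \<in> test_cone a b m"
  shows "\<exists>w'\<in>test_cone a b (Suc m). \<forall>x\<in>{a..b}. (w has_integral w' x) {x..b}"
  using assms
proof induction
  case zero
  show ?case by (rule bexI[OF _ test_cone.zero]) auto
next
  case (boundary k)
  let ?w = "\<lambda>x. (1 / real (Suc k)) * - ((b - x) ^ Suc k)"
  have I: "((\<lambda>t. - ((b - t) ^ k)) has_integral ?w x) {x..b}" if "x \<in> {a..b}" for x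
  proof -
    have "((\<lambda>t. - ((b - t) ^ k)) has_integral
        (b - b) ^ Suc k / real (Suc k) - (b - x) ^ Suc k / real (Suc k)) {x..b}"
    proof (rule fundamental_theorem_of_calculus)
      fix t :: real
      have "((\<lambda>t. (b - t) ^ Suc k) has_real_derivative real (Suc k) * (b - t) ^ k * - 1) (at t within {x..b})"
        by (rule derivative_eq_intros refl)+ simp
      then have "((\<lambda>t. (b - t) ^ Suc k / real (Suc k)) has_real_derivative
          real (Suc k) * (b - t) ^ k * - 1 / real (Suc k)) (at t within {x..b})"
        by (rule DERIV_cdivide)
      then show "((\<lambda>t. (b - t) ^ Suc k / real (Suc k)) has_vector_derivative - ((b - t) ^ k))
          (at t within {x..b})"
        by (simp add: has_real_derivative_iff_has_vector_derivative[symmetric])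
    qed (use that in auto)
    then show ?thesis by simp
  qed
  have C: "?w \<in> test_cone a b (Suc m)"
    using boundary by (intro test_cone.scale test_cone.boundary) auto
  show ?case by (intro bexI[OF _ C] ballI I)
next
  case (knot \<eta>)
  let ?w = "\<lambda>x. (1 / real (Suc m)) * - tpow (Suc m) (\<eta> - x)"
  have I: "((\<lambda>t. - tpow m (\<eta> - t)) has_integral ?w x) {x..b}" if "x \<in> {a..b}" for x
  proof -
    have "((\<lambda>t. - tpow m (\<eta> - t)) has_integral
        tpow (Suc m) (\<eta> - b) / real (Suc m) - tpow (Suc m) (\<eta> - x) / real (Suc m)) {x..b}"
    proof (rule fundamental_theorem_of_calculus_strong[where S = "{\<eta>}"])
      fix t assume t: "t \<in> {x..b} - {\<eta>}"
      have "((\<lambda>t. tpow (Suc m) (\<eta> - t)) has_real_derivative real (Suc m) * tpow m (\<eta> - t) * - 1) (at t)"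
        by (rule DERIV_chain2[of "tpow (Suc m)"])
          (use t in \<open>auto intro!: has_real_derivative_tpow derivative_eq_intros simp del: of_nat_Suc\<close>)
      then have "((\<lambda>t. tpow (Suc m) (\<eta> - t) / real (Suc m)) has_real_derivative
          real (Suc m) * tpow m (\<eta> - t) * - 1 / real (Suc m)) (at t)"
        by (rule DERIV_cdivide)
      then show "((\<lambda>t. tpow (Suc m) (\<eta> - t) / real (Suc m)) has_vector_derivative - tpow m (\<eta> - t)) (at t)"
        by (simp add: has_real_derivative_iff_has_vector_derivative[symmetric])
    qed (use that in \<open>auto intro!: continuous_intros\<close>)
    then show ?thesis using knot by (simp add: tpow_def)
  qed
  have C: "?w \<in> test_cone a b (Suc m)"
    using knot by (intro test_cone.scale test_cone.knot) auto
  show ?case by (intro bexI[OF _ C] ballI I)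
next
  case (scale w c)
  then obtain w' where "w' \<in> test_cone a b (Suc m)" "\<forall>x\<in>{a..b}. (w has_integral w' x) {x..b}"
    by blast
  then show ?case using scale
    by (intro bexI[of _ "\<lambda>x. c * w' x"] test_cone.scale) (auto intro: has_integral_mult_right)
next
  case (add v w)
  then obtain v' w' where "v' \<in> test_cone a b (Suc m)" "\<forall>x\<in>{a..b}. (v has_integral v' x) {x..b}"
    "w' \<in> test_cone a b (Suc m)" "\<forall>x\<in>{a..b}. (w has_integral w' x) {x..b}"
    by blast
  then show ?case
    by (intro bexI[of _ "\<lambda>x. v' x + w' x"] test_cone.add) (auto intro: has_integral_add)
qed

text \<open>Order one: \<open>u\<close> is approximated by \<open>u \<circ> r\<close>, where \<open>r\<close> rounds up to an equidistant grid whose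
  mesh is fine enough for the uniform continuity of \<open>u\<close>.\<close>

lemma step_approximation:
  fixes u :: "real \<Rightarrow> real"
  assumes ab: "a < b" and cont: "continuous_on {a..b} u" and mono: "mono_on {a..b} u" and \<epsilon>: "0 < \<epsilon>"
  shows "\<exists>w\<in>test_cone a b 0. \<forall>x\<in>{a..b}. \<bar>u x - (u b + w x)\<bar> \<le> \<epsilon>"
proof -
  have "uniformly_continuous_on {a..b} u"
    using cont by (simp add: compact_uniformly_continuous)
  then obtain \<delta> where \<delta>: "0 < \<delta>"
    "\<And>x y. x \<in> {a..b} \<Longrightarrow> y \<in> {a..b} \<Longrightarrow> \<bar>y - x\<bar> < \<delta> \<Longrightarrow> \<bar>u y - u x\<bar> < \<epsilon>"
    using \<epsilon> unfolding uniformly_continuous_on_def dist_real_def by meson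
  obtain N :: nat where N: "(b - a) / \<delta> < real N" using reals_Archimedean2 by blast
  then have N0: "0 < real N" using ab \<delta>(1) by (meson diff_gt_0_iff_gt divide_pos_pos order_less_trans)
  define h where "h = (b - a) / real N"
  have h: "0 < h" "h < \<delta>" "real N * h = b - a"
    using N N0 ab \<delta>(1) by (simp_all add: h_def field_simps)
  define \<eta> where "\<eta> i = a + real i * h" for i :: nat
  have \<eta>N: "\<eta> N = b" using h by (simp add: \<eta>_def)
  have \<eta>: "\<eta> i \<in> {a..<b}" if "i < N" for i
    using that h by (simp add: \<eta>_def) (smt (verit) mult_strict_right_mono of_nat_less_iff of_nat_0_le_iff mult_nonneg_nonneg)
  have \<eta>': "\<eta> i \<in> {a..b}" if "i \<le> N" for i
    using that \<eta>[of i] \<eta>N ab by (cases "i = N") auto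
  let ?w = "\<lambda>x. \<Sum>i<N. (u (\<eta> (Suc i)) - u (\<eta> i)) * - tpow 0 (\<eta> i - x)"
  have C: "?w \<in> test_cone a b 0"
  proof (intro test_cone_sum test_cone.scale test_cone.knot)
    fix i assume "i \<in> {..<N}"
    then have i: "i < N" by simp
    show "\<eta> i \<in> {a..<b}" by (rule \<eta>[OF i])
    show "0 \<le> u (\<eta> (Suc i)) - u (\<eta> i)"
      using mono_onD[OF mono \<eta>'[of i] \<eta>'[of "Suc i"]] i h by (simp add: \<eta>_def algebra_simps)
  qed
  have "\<bar>u x - (u b + ?w x)\<bar> \<le> \<epsilon>" if x: "x \<in> {a..b}" for x
  proof -
    \<comment> \<open>the index of the first grid point that is at least \<open>x\<close>\<close>
    define j where "j = nat \<lceil>(x - a) / h\<rceil>"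
    have iff: "x \<le> \<eta> i \<longleftrightarrow> j \<le> i" for i
    proof -
      have "x \<le> \<eta> i \<longleftrightarrow> (x - a) / h \<le> real i" using h by (simp add: \<eta>_def field_simps)
      also have "\<dots> \<longleftrightarrow> j \<le> i" by (simp add: j_def nat_le_iff ceiling_le_iff)
      finally show ?thesis .
    qed
    have jN: "j \<le> N" using iff[of N] x \<eta>N by simp
    have "?w x = (\<Sum>i<N. if j \<le> i then u (\<eta> i) - u (\<eta> (Suc i)) else 0)"
      using iff by (intro sum.cong) (auto simp: tpow_def)
    also have "\<dots> = (\<Sum>i\<in>{j..<N}. u (\<eta> i) - u (\<eta> (Suc i)))"
      by (intro sum.mono_neutral_cong_right) auto
    also have "\<dots> = - (\<Sum>i\<in>{j..<N}. u (\<eta> (Suc i)) - u (\<eta> i))"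
      by (simp add: sum_subtractf)
    also have "\<dots> = u (\<eta> j) - u b"
      using sum_Suc_diff'[OF jN, of "\<lambda>i. u (\<eta> i)"] \<eta>N by simp
    finally have w: "?w x = u (\<eta> j) - u b" .
    have "\<bar>x - \<eta> j\<bar> < \<delta>"
    proof (cases j)
      case 0
      then have "x = a" using iff[of 0] x by (auto simp: \<eta>_def)
      then show ?thesis using 0 \<delta> by (simp add: \<eta>_def)
    next
      case (Suc i)
      then have "\<eta> i < x" "x \<le> \<eta> j" using iff[of i] iff[of j] by auto
      moreover have "\<eta> j = \<eta> i + h" by (simp add: \<eta>_def Suc algebra_simps)
      ultimately show ?thesis using h by simp
    qed
    then have "\<bar>u x - u (\<eta> j)\<bar> < \<epsilon>" using \<delta>(2) x \<eta>'[OF jN] by blast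
    then show ?thesis using w by simp
  qed
  then show ?thesis by (intro bexI[OF _ C] ballI)
qed

lemma chain_approximation:
  assumes ab: "a < b" and "deriv_chain (Suc m) {a..b} d" and "0 < \<epsilon>"
  shows "\<exists>w\<in>test_cone a b m. \<forall>x\<in>{a..b}. \<bar>d 0 x - (d 0 b + w x)\<bar> \<le> \<epsilon>"
  using assms(2,3)
proof (induction m arbitrary: d \<epsilon>)
  case 0
  have "continuous_on {a..b} (d 0)"
    by (rule DERIV_continuous_on[where D = "d 1"]) (use 0 in \<open>auto simp: deriv_chain_def\<close>)
  moreover have "mono_on {a..b} (d 0)" using chain_mono_on 0 by auto
  ultimately show ?case using step_approximation ab 0 by blast
next
  case (Suc m)
  let ?v = "\<lambda>k x. - d (Suc k) x"
  have D: "(d k has_real_derivative d (Suc k) x) (at x within {a..b})" "0 \<le> (-1) ^ k * d (Suc k) x"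
    if "k < Suc (Suc m)" "x \<in> {a..b}" for k x
    using Suc.prems that unfolding deriv_chain_def by auto
  have "deriv_chain (Suc m) {a..b} ?v"
    unfolding deriv_chain_def
  proof (intro allI impI ballI conjI)
    fix k x assume k: "k < Suc m" "x \<in> {a..b}"
    show "(?v k has_real_derivative ?v (Suc k) x) (at x within {a..b})"
      by (rule DERIV_minus) (use D(1)[of "Suc k" x] k in auto)
    show "0 \<le> (-1) ^ k * ?v (Suc k) x"
      using D(2)[of "Suc k" x] k by simp
  qed
  moreover have \<epsilon>: "0 < \<epsilon> / (b - a)" using Suc.prems ab by simp
  ultimately obtain w where w: "w \<in> test_cone a b m"
    "\<And>x. x \<in> {a..b} \<Longrightarrow> \<bar>?v 0 x - (?v 0 b + w x)\<bar> \<le> \<epsilon> / (b - a)"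
    using Suc.IH[of ?v "\<epsilon> / (b - a)"] by blast
  obtain w' where w': "w' \<in> test_cone a b (Suc m)"
    "\<And>x. x \<in> {a..b} \<Longrightarrow> (w has_integral w' x) {x..b}"
    using test_cone_integral[OF w(1)] by blast
  \<comment> \<open>the value \<open>- d 1 b\<close> of \<open>?v 0\<close> at \<open>b\<close> integrates to a boundary function of degree one\<close>
  let ?W = "\<lambda>x. d 1 b * - ((b - x) ^ 1) + w' x"
  have "0 \<le> d 1 b" using D(2)[of 0 b] ab by simp
  then have C: "?W \<in> test_cone a b (Suc m)"
    using w'(1) by (intro test_cone.add test_cone.scale test_cone.boundary) auto
  have "\<bar>d 0 x - (d 0 b + ?W x)\<bar> \<le> \<epsilon>" if x: "x \<in> {a..b}" for x
  proof -
    have "(d 1 has_integral d 0 b - d 0 x) {x..b}"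
    proof (rule fundamental_theorem_of_calculus)
      fix t assume t: "t \<in> {x..b}"
      then have "(d 0 has_real_derivative d (Suc 0) t) (at t within {a..b})"
        using D(1)[of 0 t] x by auto
      then have "(d 0 has_real_derivative d 1 t) (at t within {x..b})"
        using x by (auto intro: DERIV_subset)
      then show "(d 0 has_vector_derivative d 1 t) (at t within {x..b})"
        by (simp add: has_real_derivative_iff_has_vector_derivative)
    qed (use x in auto)
    then have 1: "((\<lambda>t. - d 1 t) has_integral - (d 0 b - d 0 x)) {x..b}"
      by (rule has_integral_neg)
    have 2: "((\<lambda>t. - d 1 b) has_integral (b - x) * - d 1 b) {x..b}"
      using has_integral_const_real[of "- d 1 b" x b] x by simp
    have "((\<lambda>t. - d 1 t - (- d 1 b + w t)) has_integral
        - (d 0 b - d 0 x) - ((b - x) * - d 1 b + w' x)) {x..b}"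
      by (intro has_integral_diff has_integral_add 1 2 w'(2) x)
    then have "norm (- (d 0 b - d 0 x) - ((b - x) * - d 1 b + w' x)) \<le>
        \<epsilon> / (b - a) * measure lborel {x..b}"
      using w(2) x \<epsilon> by (intro has_integral_bound_real) auto
    also have "\<dots> = \<epsilon> / (b - a) * (b - x)" using x by simp
    also have "\<dots> \<le> \<epsilon> / (b - a) * (b - a)"
      using x \<epsilon> by (intro mult_left_mono) auto
    also have "\<dots> = \<epsilon>" using ab by simp
    finally show ?thesis by (simp add: algebra_simps)
  qed
  then show ?case by (intro bexI[OF _ C] ballI)
qed

context prob_space
begin

lemma test_cone_expectation:
  assumes X: "X \<in> rv_in M a b" and Y: "Y \<in> rv_in M a b"
    and knots: "\<And>\<eta>. \<eta> \<in> {a..<b} \<Longrightarrow> expectation (\<lambda>\<omega>. tpow m (\<eta> - X \<omega>)) \<le> expectation (\<lambda>\<omega>. tpow m (\<eta> - Y \<omega>))"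
    and boundary: "\<And>k. k \<in> {1..m} \<Longrightarrow> expectation (\<lambda>\<omega>. (b - X \<omega>) ^ k) \<le> expectation (\<lambda>\<omega>. (b - Y \<omega>) ^ k)"
    and w: "w \<in> test_cone a b m"
  shows "integrable M (\<lambda>\<omega>. w (X \<omega>)) \<and> integrable M (\<lambda>\<omega>. w (Y \<omega>)) \<and>
    expectation (\<lambda>\<omega>. w (Y \<omega>)) \<le> expectation (\<lambda>\<omega>. w (X \<omega>))"
  using w
proof induction
  case (boundary k)
  then show ?case
    using assms(4)[of k] integrable_power[OF X] integrable_power[OF Y] by simp
next
  case (knot \<eta>)
  then show ?case
    using knots[of \<eta>] integrable_tpow[OF X] integrable_tpow[OF Y] by simp
next
  case (scale w c)
  then show ?case by (auto intro: mult_left_mono)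
qed auto

lemma dominance_imp_prefers:
  assumes X: "X \<in> rv_in M a b" and Y: "Y \<in> rv_in M a b" and ab: "a < b"
    and knots: "\<And>\<eta>. \<eta> \<in> {a..<b} \<Longrightarrow> expectation (\<lambda>\<omega>. tpow m (\<eta> - X \<omega>)) \<le> expectation (\<lambda>\<omega>. tpow m (\<eta> - Y \<omega>))"
    and boundary: "\<And>k. k \<in> {1..m} \<Longrightarrow> expectation (\<lambda>\<omega>. (b - X \<omega>) ^ k) \<le> expectation (\<lambda>\<omega>. (b - Y \<omega>) ^ k)"
  shows "prefers M (utilities (Suc m) {a..b}) X Y"
  unfolding prefers_def
proof
  fix u assume u: "u \<in> utilities (Suc m) {a..b}"
  then obtain d where d: "d 0 = u" "deriv_chain (Suc m) {a..b} d" by (rule utilities_chain)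
  have mono: "mono_on {a..b} u" using utilities_mono_on[OF u] by simp
  show "expectation (\<lambda>\<omega>. u (Y \<omega>)) \<le> expectation (\<lambda>\<omega>. u (X \<omega>))"
  proof (rule field_le_epsilon)
    fix e :: real assume "0 < e"
    then have e: "0 < e / 2" by simp
    obtain w where w: "w \<in> test_cone a b m" "\<And>x. x \<in> {a..b} \<Longrightarrow> \<bar>u x - (u b + w x)\<bar> \<le> e / 2"
      using chain_approximation[OF ab d(2) e] d(1) by blast
    note W = test_cone_expectation[OF X Y knots boundary w(1), simplified]
    have "expectation (\<lambda>\<omega>. u (Y \<omega>)) \<le> expectation (\<lambda>\<omega>. u b + w (Y \<omega>) + e / 2)"
    proof (rule integral_mono[OF integrable_mono_comp[OF mono Y]])
      show "u (Y \<omega>) \<le> u b + w (Y \<omega>) + e / 2" if "\<omega> \<in> space M" for \<omega>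
        using w(2)[of "Y \<omega>"] rv_inD(2,3)[OF Y that] unfolding atLeastAtMost_iff by argo
    qed (use W in auto)
    also have "\<dots> = u b + expectation (\<lambda>\<omega>. w (Y \<omega>)) + e / 2"
      using W by (simp add: prob_space)
    also have "\<dots> \<le> expectation (\<lambda>\<omega>. u b + w (X \<omega>) - e / 2) + e"
      using W by (simp add: prob_space)
    also have "expectation (\<lambda>\<omega>. u b + w (X \<omega>) - e / 2) \<le> expectation (\<lambda>\<omega>. u (X \<omega>))"
    proof (rule integral_mono[OF _ integrable_mono_comp[OF mono X]])
      show "u b + w (X \<omega>) - e / 2 \<le> u (X \<omega>)" if "\<omega> \<in> space M" for \<omega>
        using w(2)[of "X \<omega>"] rv_inD(2,3)[OF X that] unfolding atLeastAtMost_iff by argo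
    qed (use W in auto)
    finally show "expectation (\<lambda>\<omega>. u (Y \<omega>)) \<le> expectation (\<lambda>\<omega>. u (X \<omega>)) + e" by simp
  qed
qed

lemma sd_iff:
  assumes "X \<in> rv_in M a b" "Y \<in> rv_in M a b"
  shows "sd M (Suc m) X Y \<longleftrightarrow>
    (\<forall>\<eta>. expectation (\<lambda>\<omega>. tpow m (\<eta> - X \<omega>)) \<le> expectation (\<lambda>\<omega>. tpow m (\<eta> - Y \<omega>)))"
  by (simp add: sd_def iter_df_rv_le_iff[OF assms])

lemma expectation_tpow_eq_power:
  assumes "X \<in> rv_in M a b" "b \<le> \<eta>"
  shows "expectation (\<lambda>\<omega>. tpow k (\<eta> - X \<omega>)) = expectation (\<lambda>\<omega>. (\<eta> - X \<omega>) ^ k)"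
  using rv_inD(3)[OF assms(1)] assms(2)
  by (intro Bochner_Integration.integral_cong) (force simp: tpow_def)+

lemma sd_on_iff:
  assumes "X \<in> rv_in M a b" "Y \<in> rv_in M a b"
  shows "sd_on M a b (Suc m) X Y \<longleftrightarrow>
    (\<forall>\<eta>\<in>{a..b}. expectation (\<lambda>\<omega>. tpow m (\<eta> - X \<omega>)) \<le> expectation (\<lambda>\<omega>. tpow m (\<eta> - Y \<omega>))) \<and>
    (\<forall>k\<le>m. expectation (\<lambda>\<omega>. (b - X \<omega>) ^ k) \<le> expectation (\<lambda>\<omega>. (b - Y \<omega>) ^ k))"
proof -
  have "(\<forall>k\<in>{1..Suc m}. iter_df_rv M X k b \<le> iter_df_rv M Y k b) \<longleftrightarrow>
      (\<forall>k\<le>m. iter_df_rv M X (Suc k) b \<le> iter_df_rv M Y (Suc k) b)"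
  proof -
    have "{1..Suc m} = Suc ` {..m}" by (simp add: image_Suc_atMost)
    then show ?thesis by auto
  qed
  then show ?thesis
    unfolding sd_on_def iter_df_rv_le_iff[OF assms] expectation_tpow_eq_power[OF assms(1) order_refl]
      expectation_tpow_eq_power[OF assms(2) order_refl] by simp
qed

end

section \<open>Truncated powers as limits of utilities\<close>

text \<open>The second forward difference of \<open>s\<^sub>+\<^sup>k\<close> with step \<open>h\<close>. Divided by \<open>(k + 1) (k + 2) h\<^sup>2\<close>, the
  second difference of \<open>s\<^sub>+\<^bsup>k+2\<^esup>\<close> converges to \<open>s\<^sub>+\<^sup>k\<close> as \<open>h\<close> decreases to \<open>0\<close>. The limit holds also
  at \<open>s = 0\<close> for \<open>k = 0\<close>, because forward differences see only the right-hand side of \<open>s\<close>.\<close>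

definition second_difference :: "nat \<Rightarrow> real \<Rightarrow> real \<Rightarrow> real" where
  "second_difference k h s = tpow k (s + 2 * h) - 2 * tpow k (s + h) + tpow k s"

lemma power_midpoint:
  fixes x y :: real
  assumes "0 \<le> x" "0 \<le> y"
  shows "2 * ((x + y) / 2) ^ k \<le> x ^ k + y ^ k"
proof -
  have "convex_on {0..} (\<lambda>x::real. x ^ k)"
  proof (cases "even k")
    case True
    then show ?thesis by (intro convex_on_subset[OF convex_power_even]) auto
  qed (rule convex_power_odd)
  from convex_onD[OF this, of "1/2" x y] assms show ?thesis
    by (simp add: field_simps)
qed

lemma second_difference_nonneg:
  assumes "0 \<le> h"
  shows "0 \<le> second_difference (Suc k) h s"
proof -
  have "max 0 (s + h) \<le> (max 0 s + max 0 (s + 2 * h)) / 2" by (auto simp: max_def)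
  then have "max 0 (s + h) ^ Suc k \<le> ((max 0 s + max 0 (s + 2 * h)) / 2) ^ Suc k"
    by (intro power_mono) auto
  with power_midpoint[of "max 0 s" "max 0 (s + 2 * h)" "Suc k"] show ?thesis
    unfolding second_difference_def tpow_Suc_eq_max by linarith
qed

lemma has_real_derivative_second_difference:
  "(second_difference (Suc (Suc k)) h has_real_derivative
     real (Suc (Suc k)) * second_difference (Suc k) h s) (at s)"
proof -
  have D: "((\<lambda>s. tpow (Suc (Suc k)) (s + c)) has_real_derivative
      real (Suc (Suc k)) * tpow (Suc k) (s + c)) (at s)" for c
    using has_real_derivative_tpow[of "s + c" "Suc k"] by (simp only: DERIV_shift) simp
  have "((\<lambda>s. tpow (Suc (Suc k)) (s + 2 * h) - 2 * tpow (Suc (Suc k)) (s + h) + tpow (Suc (Suc k)) (s + 0))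
      has_real_derivative real (Suc (Suc k)) * tpow (Suc k) (s + 2 * h) -
        2 * (real (Suc (Suc k)) * tpow (Suc k) (s + h)) + real (Suc (Suc k)) * tpow (Suc k) (s + 0)) (at s)"
    by (intro DERIV_add DERIV_diff DERIV_cmult D)
  then show ?thesis
    by (simp add: second_difference_def[abs_def] algebra_simps)
qed

text \<open>Degree \<open>m + 2\<close> is the smallest one for which \<open>m + 1\<close> derivatives exist at the knots. All of
  them are again second differences, of degree at least one, and have a sign by convexity.\<close>

lemma second_difference_in_utilities:
  assumes c: "0 \<le> c" and h: "0 \<le> h"
  shows "(\<lambda>x. - (c * second_difference (Suc (Suc m)) h (\<eta> - x))) \<in> utilities (Suc m) UNIV"
proof -
  \<comment> \<open>\<open>c\<close> times the factor produced by differentiating a power of degree \<open>m + 2\<close> \<open>j\<close> times\<close>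
  define C where "C j = c * fact (Suc (Suc m)) / fact (Suc (Suc m) - j)" for j
  define d where "d j x = - ((-1) ^ j * C j * second_difference (Suc (Suc m) - j) h (\<eta> - x))" for j x
  have "deriv_chain (Suc m) UNIV d"
    unfolding deriv_chain_def
  proof (intro allI impI ballI conjI)
    fix j x assume "j < Suc m"
    then obtain i where i: "Suc (Suc m) - j = Suc (Suc i)" "Suc (Suc m) - Suc j = Suc i"
      by (metis Suc_diff_Suc diff_Suc_Suc less_SucI)
    have C: "C (Suc j) = C j * real (Suc (Suc i))"
      unfolding C_def i fact_Suc[of "Suc i"] by (simp add: divide_simps del: fact_Suc of_nat_Suc)
    have "((\<lambda>x. second_difference (Suc (Suc i)) h (\<eta> - x)) has_real_derivative
        real (Suc (Suc i)) * second_difference (Suc i) h (\<eta> - x) * - 1) (at x)"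
      by (rule DERIV_chain2[OF has_real_derivative_second_difference]) (rule derivative_eq_intros refl | simp)+
    then have "((\<lambda>x. - ((-1) ^ j * C j * second_difference (Suc (Suc i)) h (\<eta> - x))) has_real_derivative
        - ((-1) ^ j * C j * (real (Suc (Suc i)) * second_difference (Suc i) h (\<eta> - x) * - 1))) (at x)"
      by (intro DERIV_minus DERIV_cmult)
    then show "(d j has_real_derivative d (Suc j) x) (at x within UNIV)"
      unfolding d_def[abs_def] i C power_Suc by (simp only: mult_minus1 mult_minus_left mult_minus_right mult.assoc mult_1_left mult_1_right)
    have "0 \<le> C (Suc j) * second_difference (Suc i) h (\<eta> - x)"
      using c h by (intro mult_nonneg_nonneg second_difference_nonneg) (auto simp: C_def)
    then show "0 \<le> (-1) ^ j * d (Suc j) x"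
      unfolding d_def i by (cases "even j") simp_all
  qed
  then have "d 0 \<in> utilities (Suc m) UNIV"
    by (intro chain_in_utilities) auto
  moreover have "d 0 = (\<lambda>x. - (c * second_difference (Suc (Suc m)) h (\<eta> - x)))"
    by (rule ext) (simp add: d_def C_def)
  ultimately show ?thesis by simp
qed

lemma second_difference_mean_value:
  assumes s: "0 \<le> s" and h: "0 < h"
  obtains z where "s < z" "z < s + 2 * h"
    "second_difference (Suc (Suc k)) h s = real (Suc (Suc k)) * real (Suc k) * z ^ k * h\<^sup>2"
proof -
  have D: "((\<lambda>t. (t + c) ^ Suc i) has_real_derivative real (Suc i) * (t + c) ^ i) (at t)"
    for c t :: real and i
    by (rule derivative_eq_intros refl)+ simp
  let ?f = "\<lambda>t. (t + h) ^ Suc (Suc k) - (t + 0) ^ Suc (Suc k)"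
  let ?f' = "\<lambda>t. real (Suc (Suc k)) * (t + h) ^ Suc k - real (Suc (Suc k)) * (t + 0) ^ Suc k"
  have "(?f has_real_derivative ?f' t) (at t)" for t
    by (intro DERIV_diff D)
  then have "\<exists>y>s. y < s + h \<and> ?f (s + h) - ?f s = (s + h - s) * ?f' y"
    using h by (intro MVT2) auto
  then obtain y where y: "s < y" "y < s + h" "?f (s + h) - ?f s = (s + h - s) * ?f' y"
    by blast
  have "\<exists>z>y. z < y + h \<and> (y + h + 0) ^ Suc k - (y + 0) ^ Suc k = (y + h - y) * (real (Suc k) * (z + 0) ^ k)"
    using h by (intro MVT2 D) auto
  then obtain z where z: "y < z" "z < y + h"
    "(y + h + 0) ^ Suc k - (y + 0) ^ Suc k = (y + h - y) * (real (Suc k) * (z + 0) ^ k)"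
    by blast
  show ?thesis
  proof
    show "s < z" "z < s + 2 * h" using y z by auto
    have "second_difference (Suc (Suc k)) h s = ?f (s + h) - ?f s"
      using s h by (simp add: second_difference_def tpow_def algebra_simps del: power_Suc)
    also have "\<dots> = h * (real (Suc (Suc k)) * ((y + h + 0) ^ Suc k - (y + 0) ^ Suc k))"
      unfolding y(3) by (simp add: algebra_simps del: power_Suc)
    also have "\<dots> = real (Suc (Suc k)) * real (Suc k) * z ^ k * h\<^sup>2"
      unfolding z(3) by (simp add: power2_eq_square del: of_nat_Suc)
    finally show "second_difference (Suc (Suc k)) h s = real (Suc (Suc k)) * real (Suc k) * z ^ k * h\<^sup>2" .
  qed
qed

lemma second_difference_limit:
  fixes k :: nat
  defines "h \<equiv> \<lambda>i. inverse (real (Suc i))"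
  defines "c \<equiv> \<lambda>i. inverse (real (Suc (Suc k)) * real (Suc k) * (h i)\<^sup>2)"
  shows "(\<lambda>i. c i * second_difference (Suc (Suc k)) (h i) s) \<longlonglongrightarrow> tpow k s"
proof (cases "0 \<le> s")
  case True
  have h: "0 < h i" for i by (simp add: h_def)
  have "\<exists>z. s < z \<and> z < s + 2 * h i \<and> c i * second_difference (Suc (Suc k)) (h i) s = z ^ k" for i
  proof -
    obtain z where z: "s < z" "z < s + 2 * h i"
      "second_difference (Suc (Suc k)) (h i) s = real (Suc (Suc k)) * real (Suc k) * z ^ k * (h i)\<^sup>2"
      by (rule second_difference_mean_value[OF True h])
    have "c i * second_difference (Suc (Suc k)) (h i) s = z ^ k"
      unfolding c_def z(3) using h[of i] by (simp add: field_simps del: of_nat_Suc)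
    with z show ?thesis by blast
  qed
  then obtain z where z: "\<And>i. s < z i" "\<And>i. z i < s + 2 * h i"
    "\<And>i. c i * second_difference (Suc (Suc k)) (h i) s = z i ^ k" by metis
  have "h \<longlonglongrightarrow> 0" unfolding h_def by (rule LIMSEQ_inverse_real_of_nat)
  then have "(\<lambda>i. s + 2 * h i) \<longlonglongrightarrow> s + 2 * 0" by (intro tendsto_intros)
  then have "(\<lambda>i. s + 2 * h i) \<longlonglongrightarrow> s" by simp
  then have "z \<longlonglongrightarrow> s"
    by (rule tendsto_sandwich[OF _ _ tendsto_const, rotated 2])
      (auto intro!: always_eventually less_imp_le z)
  then have "(\<lambda>i. z i ^ k) \<longlonglongrightarrow> s ^ k" by (rule tendsto_power)
  then show ?thesis using True by (simp add: z(3) tpow_def)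
next
  case False
  then have "0 < - s / 2" by simp
  then have "\<forall>\<^sub>F i in sequentially. h i < - s / 2"
    unfolding h_def using LIMSEQ_inverse_real_of_nat by (rule order_tendstoD(2)[rotated])
  then have "\<forall>\<^sub>F i in sequentially. c i * second_difference (Suc (Suc k)) (h i) s = tpow k s"
  proof eventually_elim
    case (elim i)
    have "0 < h i" by (simp add: h_def)
    with elim False show ?case by (simp add: second_difference_def tpow_def)
  qed
  then show ?thesis by (rule tendsto_eventually)
qed

lemma neg_tpow_in_closure:
  "(\<lambda>x. - tpow m (\<eta> - x)) \<in> closed_utilities (Suc m) UNIV"
  unfolding closed_utilities_def
proof (rule closure_pointwise_limit)
  let ?h = "\<lambda>i. inverse (real (Suc i))"
  let ?c = "\<lambda>i. inverse (real (Suc (Suc m)) * real (Suc m) * (?h i)\<^sup>2)"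
  show "(\<lambda>x. - (?c i * second_difference (Suc (Suc m)) (?h i) (\<eta> - x))) \<in> utilities (Suc m) UNIV" for i
    by (rule second_difference_in_utilities) auto
  show "(\<lambda>i. - (?c i * second_difference (Suc (Suc m)) (?h i) (\<eta> - x))) \<longlonglongrightarrow> - tpow m (\<eta> - x)" for x
    by (intro tendsto_minus second_difference_limit)
qed

lemma boundary_power_in_utilities:
  assumes ab: "a < b" and k: "k \<le> m"
  shows "(\<lambda>x. - ((b - x) ^ k)) \<in> utilities (Suc m) {a..b}"
proof -
  \<comment> \<open>a falling factorial, which is \<open>0\<close> for \<open>j > k\<close>, where \<open>k - j\<close> is truncated\<close>
  define C where "C j = (\<Prod>i<j. real k - real i)" for j
  define d where "d j x = - ((-1) ^ j * C j * (b - x) ^ (k - j))" for j x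
  have C: "0 \<le> C j" for j
  proof (cases "j \<le> k")
    case True
    then show ?thesis unfolding C_def by (intro prod_nonneg) auto
  next
    case False
    then have "C j = 0" unfolding C_def by (intro prod_zero) auto
    then show ?thesis by simp
  qed
  have "deriv_chain (Suc m) {a..b} d"
    unfolding deriv_chain_def
  proof (intro allI impI ballI conjI)
    fix j x assume x: "x \<in> {a..b}"
    have CS: "C (Suc j) = C j * (real k - real j)" by (simp add: C_def)
    have "((\<lambda>x. (b - x) ^ (k - j)) has_real_derivative real (k - j) * (b - x) ^ (k - j - 1) * - 1) (at x within {a..b})"
      by (rule derivative_eq_intros refl)+ simp
    then have "((\<lambda>x. - ((-1) ^ j * C j * (b - x) ^ (k - j))) has_real_derivative
        - ((-1) ^ j * C j * (real (k - j) * (b - x) ^ (k - j - 1) * - 1))) (at x within {a..b})"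
      by (intro DERIV_minus DERIV_cmult)
    moreover have CS': "C (Suc j) = C j * real (k - j)"
    proof (cases "j \<le> k")
      case False
      then have "C j = 0" unfolding C_def by (intro prod_zero) auto
      then show ?thesis by (simp add: CS)
    qed (simp add: CS of_nat_diff)
    ultimately show "(d j has_real_derivative d (Suc j) x) (at x within {a..b})"
      unfolding CS' d_def[abs_def] by (simp add: algebra_simps)
    have "0 \<le> C (Suc j) * (b - x) ^ (k - Suc j)"
      using x C by (intro mult_nonneg_nonneg) auto
    then show "0 \<le> (-1) ^ j * d (Suc j) x"
      unfolding d_def by (cases "even j") simp_all
  qed
  then have "d 0 \<in> utilities (Suc m) {a..b}"
    using ab by (intro chain_in_utilities at_within_Icc_neq_bot)
  moreover have "d 0 = (\<lambda>x. - ((b - x) ^ k))"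
    by (rule ext) (simp add: d_def C_def)
  ultimately show ?thesis by simp
qed

section \<open>Moments beyond the right end point\<close>

lemma lead_coeff_nonneg_iff_eventually:
  fixes p :: "real poly"
  shows "0 \<le> lead_coeff p \<longleftrightarrow> (\<forall>\<^sub>F x in at_top. 0 \<le> poly p x)"
proof -
  have pos: "\<forall>\<^sub>F x in at_top. 0 < poly q x" if q: "0 < lead_coeff q" for q :: "real poly"
  proof -
    from poly_pinfty_gt_lc[OF q] obtain n where "\<forall>x\<ge>n. lead_coeff q \<le> poly q x" by blast
    then show ?thesis
      using q unfolding eventually_at_top_linorder by (meson order_less_le_trans)
  qed
  show ?thesis
  proof
    assume "0 \<le> lead_coeff p"
    then consider "p = 0" | "0 < lead_coeff p" by fastforce
    then show "\<forall>\<^sub>F x in at_top. 0 \<le> poly p x"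
    proof cases
      case 2
      then show ?thesis using pos eventually_mono by fastforce
    qed simp
  next
    assume p: "\<forall>\<^sub>F x in at_top. 0 \<le> poly p x"
    show "0 \<le> lead_coeff p"
    proof (rule ccontr)
      assume "\<not> 0 \<le> lead_coeff p"
      then have "0 < lead_coeff (- p)" by simp
      from pos[OF this] have "\<forall>\<^sub>F x in at_top. poly p x < 0" by simp
      with p have "\<forall>\<^sub>F x::real in at_top. False"
        by eventually_elim simp
      then show False by simp
    qed
  qed
qed

lemma eventually_nonneg_pderiv:
  fixes p :: "real poly"
  assumes "\<forall>\<^sub>F x in at_top. 0 \<le> poly p x"
  shows "\<forall>\<^sub>F x in at_top. 0 \<le> poly (pderiv p) x"
proof -
  have "lead_coeff (pderiv p) = real (degree p) * lead_coeff p"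
    by (cases "degree p") (simp_all add: degree_pderiv coeff_pderiv coeff_eq_0)
  then show ?thesis
    using assms lead_coeff_nonneg_iff_eventually[of p] lead_coeff_nonneg_iff_eventually[of "pderiv p"]
    by simp
qed

text \<open>If \<open>c j = E[(-X)\<^sup>j]\<close>, this is the polynomial \<open>\<eta> \<mapsto> E[(\<eta> - X)\<^sup>m]\<close>.\<close>

definition shifted_moment_poly :: "(nat \<Rightarrow> real) \<Rightarrow> nat \<Rightarrow> real poly" where
  "shifted_moment_poly c m = (\<Sum>j\<le>m. monom (real (m choose j) * c j) (m - j))"

lemma pderiv_shifted_moment_poly:
  "pderiv (shifted_moment_poly c (Suc m)) = smult (real (Suc m)) (shifted_moment_poly c m)"
proof -
  have "pderiv (shifted_moment_poly c (Suc m)) =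
      (\<Sum>j\<le>Suc m. monom (real (Suc m - j) * (real (Suc m choose j) * c j)) (Suc m - j - 1))"
    by (simp only: shifted_moment_poly_def higher_pderiv_sum[where n = "Suc 0", simplified] pderiv_monom)
  also have "\<dots> = (\<Sum>j\<le>m. monom (real (Suc m - j) * (real (Suc m choose j) * c j)) (Suc m - j - 1))"
    by (simp only: sum.atMost_Suc) simp
  also have "\<dots> = (\<Sum>j\<le>m. smult (real (Suc m)) (monom (real (m choose j) * c j) (m - j)))"
  proof (rule sum.cong[OF refl])
    fix j assume "j \<in> {..m}"
    have "real (Suc m - j) * real (Suc m choose j) = real (Suc m) * real (m choose j)"
      using binomial_absorb_comp[of "Suc m" j] by (metis diff_Suc_1 of_nat_mult)
    then show "monom (real (Suc m - j) * (real (Suc m choose j) * c j)) (Suc m - j - 1) =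
        smult (real (Suc m)) (monom (real (m choose j) * c j) (m - j))"
      by (simp add: smult_monom mult.assoc[symmetric])
  qed
  also have "\<dots> = [:real (Suc m):] * shifted_moment_poly c m"
    by (simp add: shifted_moment_poly_def sum_distrib_left)
  finally show ?thesis by simp
qed

context prob_space
begin

lemma expectation_power_shift:
  assumes X: "X \<in> rv_in M a b"
  shows "expectation (\<lambda>\<omega>. (\<eta> - X \<omega>) ^ m) =
    poly (shifted_moment_poly (\<lambda>j. expectation (\<lambda>\<omega>. (- X \<omega>) ^ j)) m) \<eta>"
proof -
  have int: "integrable M (\<lambda>\<omega>. (- X \<omega>) ^ j)" for j
    using integrable_power[OF X, of 0 j] by simp
  have "expectation (\<lambda>\<omega>. (\<eta> - X \<omega>) ^ m) =
      expectation (\<lambda>\<omega>. \<Sum>j\<le>m. real (m choose j) * (- X \<omega>) ^ j * \<eta> ^ (m - j))"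
    using binomial_ring[of "- X _" \<eta> m] by (intro Bochner_Integration.integral_cong) (simp_all add: add.commute)
  also have "\<dots> = (\<Sum>j\<le>m. real (m choose j) * expectation (\<lambda>\<omega>. (- X \<omega>) ^ j) * \<eta> ^ (m - j))"
    using int by (subst Bochner_Integration.integral_sum) auto
  finally show ?thesis
    by (simp add: shifted_moment_poly_def poly_sum poly_monom)
qed

lemma eventually_moments_ordered:
  assumes X: "X \<in> rv_in M a b" and Y: "Y \<in> rv_in M a b"
    and top: "\<forall>\<^sub>F \<eta> in at_top. expectation (\<lambda>\<omega>. (\<eta> - X \<omega>) ^ m) \<le> expectation (\<lambda>\<omega>. (\<eta> - Y \<omega>) ^ m)"
    and "k \<le> m"
  shows "\<forall>\<^sub>F \<eta> in at_top. expectation (\<lambda>\<omega>. (\<eta> - X \<omega>) ^ k) \<le> expectation (\<lambda>\<omega>. (\<eta> - Y \<omega>) ^ k)"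
proof -
  define p where "p Z j = shifted_moment_poly (\<lambda>j. expectation (\<lambda>\<omega>. (- Z \<omega>) ^ j)) j" for Z j
  have iff: "expectation (\<lambda>\<omega>. (\<eta> - X \<omega>) ^ j) \<le> expectation (\<lambda>\<omega>. (\<eta> - Y \<omega>) ^ j) \<longleftrightarrow>
      0 \<le> poly (p Y j - p X j) \<eta>" for \<eta> j
    by (simp add: expectation_power_shift[OF X] expectation_power_shift[OF Y] p_def)
  have "\<forall>\<^sub>F \<eta> in at_top. 0 \<le> poly (p Y k - p X k) \<eta>"
    using \<open>k \<le> m\<close>
  proof (induction rule: inc_induct)
    case base
    show ?case using top unfolding iff .
  next
    case (step j)
    have "pderiv (p Y (Suc j) - p X (Suc j)) = smult (real (Suc j)) (p Y j - p X j)"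
      by (simp add: p_def pderiv_diff pderiv_shifted_moment_poly smult_diff_right del: of_nat_Suc)
    with eventually_nonneg_pderiv[OF step.IH] show ?case
      by (simp add: zero_le_mult_iff del: of_nat_Suc)
  qed
  then show ?thesis unfolding iff .
qed

section \<open>Dominance as preference\<close>

lemma prefers_subset: "A \<subseteq> B \<Longrightarrow> prefers M B X Y \<Longrightarrow> prefers M A X Y"
  by (auto simp: prefers_def)

lemma prefers_closed_utilities_iff:
  assumes X: "X \<in> rv_in M a b" and Y: "Y \<in> rv_in M a b" and ab: "a < b"
    and n: "1 \<le> n" and S: "{a..b} \<subseteq> S"
  shows "prefers M (utilities n S) X Y \<longleftrightarrow> prefers M (closed_utilities n S) X Y"
  unfolding closed_utilities_def
proof
  assume P: "prefers M (utilities n S) X Y"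
  show "prefers M (closure (utilities n S)) X Y"
    by (rule prefers_closure[OF X Y less_imp_le[OF ab] utilities_mono_on[OF _ S n] P])
qed (rule prefers_subset[OF closure_subset])

lemma prefers_UNIV_imp_sd:
  assumes X: "X \<in> rv_in M a b" and Y: "Y \<in> rv_in M a b" and ab: "a < b"
    and P: "prefers M (utilities (Suc m) UNIV) X Y"
  shows "sd M (Suc m) X Y"
  unfolding sd_iff[OF X Y]
proof
  fix \<eta>
  have "prefers M (closed_utilities (Suc m) UNIV) X Y"
    using P prefers_closed_utilities_iff[OF X Y ab, of "Suc m" UNIV] by simp
  from this[unfolded prefers_def, rule_format, OF neg_tpow_in_closure[of m \<eta>]]
  show "expectation (\<lambda>\<omega>. tpow m (\<eta> - X \<omega>)) \<le> expectation (\<lambda>\<omega>. tpow m (\<eta> - Y \<omega>))"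
    by simp
qed

lemma sd_on_iff_prefers:
  assumes X: "X \<in> rv_in M a b" and Y: "Y \<in> rv_in M a b" and ab: "a < b"
  shows "sd_on M a b (Suc m) X Y \<longleftrightarrow> prefers M (utilities (Suc m) {a..b}) X Y"
proof
  assume "sd_on M a b (Suc m) X Y"
  then show "prefers M (utilities (Suc m) {a..b}) X Y"
    unfolding sd_on_iff[OF X Y] by (intro dominance_imp_prefers[OF X Y ab]) auto
next
  assume P: "prefers M (utilities (Suc m) {a..b}) X Y"
  then have "prefers M (utilities (Suc m) UNIV) X Y"
    by (rule prefers_subset[OF utilities_restrict[OF ab]])
  from prefers_UNIV_imp_sd[OF X Y ab this]
  have "\<forall>\<eta>. expectation (\<lambda>\<omega>. tpow m (\<eta> - X \<omega>)) \<le> expectation (\<lambda>\<omega>. tpow m (\<eta> - Y \<omega>))"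
    unfolding sd_iff[OF X Y] .
  moreover have "expectation (\<lambda>\<omega>. (b - X \<omega>) ^ k) \<le> expectation (\<lambda>\<omega>. (b - Y \<omega>) ^ k)" if "k \<le> m" for k
    using P[unfolded prefers_def, rule_format, OF boundary_power_in_utilities[OF ab that]] by simp
  ultimately show "sd_on M a b (Suc m) X Y"
    unfolding sd_on_iff[OF X Y] by auto
qed

lemma sd_imp_ordered_moments_beyond:
  assumes X: "X \<in> rv_in M a b" and Y: "Y \<in> rv_in M a b" and sd: "sd M (Suc m) X Y"
  obtains B where "b \<le> B"
    "\<And>k. k \<le> m \<Longrightarrow> expectation (\<lambda>\<omega>. (B - X \<omega>) ^ k) \<le> expectation (\<lambda>\<omega>. (B - Y \<omega>) ^ k)"
proof -
  have "\<forall>\<^sub>F \<eta> in at_top. expectation (\<lambda>\<omega>. (\<eta> - X \<omega>) ^ m) \<le> expectation (\<lambda>\<omega>. (\<eta> - Y \<omega>) ^ m)"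
    using eventually_ge_at_top[of b]
    by eventually_elim (use sd[unfolded sd_iff[OF X Y]] in
      \<open>simp add: expectation_tpow_eq_power[OF X, symmetric] expectation_tpow_eq_power[OF Y, symmetric]\<close>)
  then have "\<forall>k\<in>{..m}. \<forall>\<^sub>F \<eta> in at_top. expectation (\<lambda>\<omega>. (\<eta> - X \<omega>) ^ k) \<le> expectation (\<lambda>\<omega>. (\<eta> - Y \<omega>) ^ k)"
    using eventually_moments_ordered[OF X Y] by auto
  then have "\<forall>\<^sub>F \<eta> in at_top. b \<le> \<eta> \<and> (\<forall>k\<in>{..m}. expectation (\<lambda>\<omega>. (\<eta> - X \<omega>) ^ k) \<le> expectation (\<lambda>\<omega>. (\<eta> - Y \<omega>) ^ k))"
    by (intro eventually_conj eventually_ge_at_top) (simp add: eventually_ball_finite_distrib)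
  then obtain B where "b \<le> B \<and> (\<forall>k\<in>{..m}. expectation (\<lambda>\<omega>. (B - X \<omega>) ^ k) \<le> expectation (\<lambda>\<omega>. (B - Y \<omega>) ^ k))"
    by (auto dest!: eventually_happens)
  then show ?thesis using that by auto
qed

lemma rv_in_mono: "X \<in> rv_in M a b \<Longrightarrow> b \<le> B \<Longrightarrow> X \<in> rv_in M a B"
  by (force simp: rv_in_def)

text \<open>Dominance on the line implies dominance on \<open>[a, B]\<close> for some \<open>B \<ge> b\<close>, and utilities on the line
  are utilities on \<open>[a, B]\<close>.\<close>

lemma sd_iff_prefers:
  assumes X: "X \<in> rv_in M a b" and Y: "Y \<in> rv_in M a b" and ab: "a < b"
  shows "sd M (Suc m) X Y \<longleftrightarrow> prefers M (utilities (Suc m) UNIV) X Y"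
proof
  assume sd: "sd M (Suc m) X Y"
  obtain B where B: "b \<le> B"
    "\<And>k. k \<le> m \<Longrightarrow> expectation (\<lambda>\<omega>. (B - X \<omega>) ^ k) \<le> expectation (\<lambda>\<omega>. (B - Y \<omega>) ^ k)"
    using sd_imp_ordered_moments_beyond[OF X Y sd] by blast
  have "a < B" using ab B by simp
  have "prefers M (utilities (Suc m) {a..B}) X Y"
    using sd[unfolded sd_iff[OF X Y]] B \<open>a < B\<close>
    by (intro dominance_imp_prefers rv_in_mono[OF X] rv_in_mono[OF Y]) auto
  then show "prefers M (utilities (Suc m) UNIV) X Y"
    by (rule prefers_subset[OF utilities_restrict[OF \<open>a < B\<close>]])
qed (rule prefers_UNIV_imp_sd[OF X Y ab])

end

section \<open>Comparison of the two dominance relations\<close>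

context prob_space
begin

lemma ex_two_point_rv:
  assumes realise: "\<And>D. real_distribution D \<Longrightarrow> measure D {a..b} = 1 \<Longrightarrow>
      \<exists>X\<in>rv_in M a b. distr M borel X = D"
    and p: "p \<in> {0..1}" and st: "s \<in> {a..b}" "t \<in> {a..b}"
  shows "\<exists>X\<in>rv_in M a b. \<forall>g\<in>borel_measurable borel.
    expectation (\<lambda>\<omega>. g (X \<omega>)) = p * g s + (1 - p) * (g t :: real)"
proof -
  let ?f = "\<lambda>c::bool. if c then s else t"
  let ?D = "distr (measure_pmf (bernoulli_pmf p)) borel ?f"
  have f: "?f \<in> measurable (measure_pmf (bernoulli_pmf p)) borel" by simp
  have "real_distribution ?D" by (rule prob_space.real_distribution_distr[OF measure_pmf.prob_space_axioms f])
  moreover have "measure ?D {a..b} = 1"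
  proof -
    have "?f -` {a..b} \<inter> space (measure_pmf (bernoulli_pmf p)) = UNIV" using st by auto
    then show ?thesis by (subst measure_distr[OF f]) auto
  qed
  ultimately obtain X where X: "X \<in> rv_in M a b" "distr M borel X = ?D"
    using realise by blast
  have "expectation (\<lambda>\<omega>. g (X \<omega>)) = p * g s + (1 - p) * g t"
    if g: "g \<in> borel_measurable borel" for g :: "real \<Rightarrow> real"
  proof -
    have "expectation (\<lambda>\<omega>. g (X \<omega>)) = integral\<^sup>L ?D g"
      using integral_distr[OF rv_inD(1)[OF X(1)] g] X(2) by simp
    also have "\<dots> = measure_pmf.expectation (bernoulli_pmf p) (\<lambda>c. g (?f c))"
      by (rule integral_distr[OF f g])
    also have "\<dots> = p * g s + (1 - p) * g t"
      using p by simp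
    finally show ?thesis .
  qed
  then show ?thesis using X(1) by blast
qed

text \<open>This is dominance of order \<open>4\<close> for the two-point distributions of the counterexample below, up
  to translation and scaling. For \<open>q \<ge> 0\<close> the difference of the two sides is \<open>1 - 3 q + 3 q\<^sup>2\<close>,
  which is positive although its slope at \<open>q = 0\<close> is negative.\<close>

lemma tpow_3_four_point:
  "3 * tpow 3 q + 4 * tpow 3 (q + 2) \<le> 6 * tpow 3 (q + 1) + tpow 3 (q + 3)"
proof -
  consider "q < -3" | "-3 \<le> q" "q < -2" | "-2 \<le> q" "q < -1" | "-1 \<le> q" "q < 0" | "0 \<le> q" by linarith
  then show ?thesis
  proof cases
    case 3
    define y where "y = q + 2"
    have y: "0 \<le> y" "y \<le> 1" using 3 by (simp_all add: y_def)
    have "3 * y ^ 3 \<le> 3 * y ^ 2"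
      using y by (simp add: power_decreasing)
    then have "4 * y ^ 3 \<le> (y + 1) ^ 3"
      using y by (simp add: power3_eq_cube power2_eq_square algebra_simps)
    moreover have "y + 1 = q + 3" by (simp add: y_def)
    ultimately show ?thesis using 3 by (simp add: tpow_def y_def add.commute)
  next
    case 4
    define y where "y = q + 1"
    have y: "0 \<le> y" "y \<le> 1" using 4 by (simp_all add: y_def)
    have "y * y \<le> y" using y mult_left_le_one_le[of y y] by simp
    then have "0 \<le> 1 + 3 * ((1 - y) * (1 + y - y * y))"
      using y by (intro add_nonneg_nonneg mult_nonneg_nonneg) auto
    then have "4 * (y + 1) ^ 3 \<le> 6 * y ^ 3 + (y + 2) ^ 3"
      by (simp add: power3_eq_cube algebra_simps)
    moreover have "y + 1 = q + 2" "y + 2 = q + 3" by (simp_all add: y_def)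
    ultimately show ?thesis using 4 by (simp add: tpow_def y_def add.commute)
  next
    case 5
    have "0 \<le> 3 * (q - 1 / 2)\<^sup>2 + 1 / 4" by simp
    then have "3 * q ^ 3 + 4 * (q + 2) ^ 3 \<le> 6 * (q + 1) ^ 3 + (q + 3) ^ 3"
      by (simp add: power3_eq_cube power2_eq_square algebra_simps)
    then show ?thesis using 5 by (simp add: tpow_def)
  qed (auto simp: tpow_def)
qed

text \<open>With \<open>h = (b - a) / 3\<close>, the variable \<open>(b - X) / h\<close> takes the values \<open>0\<close> and \<open>2\<close> with
  probabilities \<open>3/7\<close> and \<open>4/7\<close>, and \<open>(b - Y) / h\<close> takes the values \<open>1\<close> and \<open>3\<close> with
  probabilities \<open>6/7\<close> and \<open>1/7\<close>. The second moments are \<open>16/7\<close> and \<open>15/7\<close>.\<close>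

lemma ex_sd_4_not_second_moment_ordered:
  assumes realise: "\<And>D. real_distribution D \<Longrightarrow> measure D {a..b} = 1 \<Longrightarrow>
      \<exists>X\<in>rv_in M a b. distr M borel X = D"
    and ab: "a < b"
  shows "\<exists>X\<in>rv_in M a b. \<exists>Y\<in>rv_in M a b. sd M 4 X Y \<and>
    expectation (\<lambda>\<omega>. (b - Y \<omega>)\<^sup>2) < expectation (\<lambda>\<omega>. (b - X \<omega>)\<^sup>2)"
proof -
  define h where "h = (b - a) / 3"
  have h: "0 < h" "3 * h = b - a" using ab by (simp_all add: h_def)
  have "\<exists>X\<in>rv_in M a b. \<forall>g\<in>borel_measurable borel.
      expectation (\<lambda>\<omega>. g (X \<omega>)) = 3 / 7 * g b + (1 - 3 / 7) * (g (b - 2 * h) :: real)"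
    using h ab by (intro ex_two_point_rv[OF realise]) auto
  then obtain X where X: "X \<in> rv_in M a b" and EX: "\<And>g :: real \<Rightarrow> real. g \<in> borel_measurable borel \<Longrightarrow>
      expectation (\<lambda>\<omega>. g (X \<omega>)) = 3 / 7 * g b + (1 - 3 / 7) * g (b - 2 * h)"
    by blast
  have "\<exists>Y\<in>rv_in M a b. \<forall>g\<in>borel_measurable borel.
      expectation (\<lambda>\<omega>. g (Y \<omega>)) = 6 / 7 * g (b - h) + (1 - 6 / 7) * (g (b - 3 * h) :: real)"
    using h ab by (intro ex_two_point_rv[OF realise]) auto
  then obtain Y where Y: "Y \<in> rv_in M a b" and EY: "\<And>g :: real \<Rightarrow> real. g \<in> borel_measurable borel \<Longrightarrow>
      expectation (\<lambda>\<omega>. g (Y \<omega>)) = 6 / 7 * g (b - h) + (1 - 6 / 7) * g (b - 3 * h)"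
    by blast
  have "sd M (Suc 3) X Y"
    unfolding sd_iff[OF X Y]
  proof
    fix \<eta>
    define q where "q = (\<eta> - b) / h"
    have q: "tpow 3 (\<eta> - (b - j * h)) = h ^ 3 * tpow 3 (q + j)" for j
    proof -
      have "\<eta> - (b - j * h) = h * (q + j)" using h(1) by (simp add: q_def field_simps)
      then show ?thesis using tpow_mult[OF h(1)] by simp
    qed
    have "3 / 7 * tpow 3 q + 4 / 7 * tpow 3 (q + 2) \<le> 6 / 7 * tpow 3 (q + 1) + 1 / 7 * tpow 3 (q + 3)"
      using tpow_3_four_point[of q] by simp
    then have "h ^ 3 * (3 / 7 * tpow 3 q + 4 / 7 * tpow 3 (q + 2)) \<le>
        h ^ 3 * (6 / 7 * tpow 3 (q + 1) + 1 / 7 * tpow 3 (q + 3))"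
      using h(1) by (intro mult_left_mono) auto
    then show "expectation (\<lambda>\<omega>. tpow 3 (\<eta> - X \<omega>)) \<le> expectation (\<lambda>\<omega>. tpow 3 (\<eta> - Y \<omega>))"
      using q[of 0] q[of 1] q[of 2] q[of 3]
      by (subst EX[of "\<lambda>x. tpow 3 (\<eta> - x)"], simp, subst EY[of "\<lambda>x. tpow 3 (\<eta> - x)"], simp)
        (simp add: algebra_simps)
  qed
  moreover have "expectation (\<lambda>\<omega>. (b - Y \<omega>)\<^sup>2) < expectation (\<lambda>\<omega>. (b - X \<omega>)\<^sup>2)"
    using h(1)
    by (subst EX[of "\<lambda>x. (b - x)\<^sup>2"], simp, subst EY[of "\<lambda>x. (b - x)\<^sup>2"], simp)
      (simp add: power_mult_distrib)
  ultimately show ?thesis using X Y by auto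
qed

text \<open>Here \<open>k \<le> m \<le> 2\<close>, so each boundary condition is trivial (\<open>k = 0\<close>), or part of dominance on the
  line (\<open>k = m\<close>), or concerns first moments, whose difference is the same at \<open>b\<close> and at \<open>B\<close>.\<close>

lemma sd_imp_sd_on:
  assumes X: "X \<in> rv_in M a b" and Y: "Y \<in> rv_in M a b" and m: "m \<le> 2"
    and sd: "sd M (Suc m) X Y"
  shows "sd_on M a b (Suc m) X Y"
  unfolding sd_on_iff[OF X Y]
proof (intro conjI ballI allI impI)
  note le = sd[unfolded sd_iff[OF X Y], rule_format]
  show "expectation (\<lambda>\<omega>. tpow m (\<eta> - X \<omega>)) \<le> expectation (\<lambda>\<omega>. tpow m (\<eta> - Y \<omega>))" for \<eta>
    by (rule le)
  fix k assume k: "k \<le> m"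
  consider "k = 0" | "k = m" | "k = 1" using k m by linarith
  then show "expectation (\<lambda>\<omega>. (b - X \<omega>) ^ k) \<le> expectation (\<lambda>\<omega>. (b - Y \<omega>) ^ k)"
  proof cases
    case 2
    then show ?thesis
      using le[of b] by (simp add: expectation_tpow_eq_power[OF X] expectation_tpow_eq_power[OF Y])
  next
    case 3
    obtain B where "expectation (\<lambda>\<omega>. (B - X \<omega>) ^ k) \<le> expectation (\<lambda>\<omega>. (B - Y \<omega>) ^ k)"
      using sd_imp_ordered_moments_beyond[OF X Y sd] k by blast
    moreover have "expectation (\<lambda>\<omega>. (b - Z \<omega>) ^ k) = expectation (\<lambda>\<omega>. (B - Z \<omega>) ^ k) + (b - B)"
      if Z: "Z \<in> rv_in M a b" for Z
    proof -
      have "expectation (\<lambda>\<omega>. (b - Z \<omega>) ^ k) = expectation (\<lambda>\<omega>. (B - Z \<omega>) ^ 1 + (b - B))"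
        by (simp add: 3)
      also have "\<dots> = expectation (\<lambda>\<omega>. (B - Z \<omega>) ^ k) + (b - B)"
        using integrable_power[OF Z, of B 1] by (subst Bochner_Integration.integral_add) (auto simp: 3 prob_space)
      finally show ?thesis .
    qed
    ultimately show ?thesis using X Y by simp
  qed simp
qed

lemma sd_higher_order:
  assumes X: "X \<in> rv_in M a b" and Y: "Y \<in> rv_in M a b" and ab: "a < b"
    and mn: "Suc m \<le> n" and sd: "sd M (Suc m) X Y"
  shows "sd M n X Y"
  using mn
proof (induction n rule: dec_induct)
  case base
  show ?case by (rule sd)
next
  case (step n)
  then obtain k where k: "n = Suc k" by (cases n) auto
  have "utilities (Suc n) UNIV \<subseteq> utilities n UNIV"
    unfolding utilities_def by auto
  then show ?case
    using step.IH unfolding k sd_iff_prefers[OF X Y ab] by (rule prefers_subset)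
qed

end

theorem proposition1:
  fixes M :: "'w measure" and a b :: real and n :: nat
  assumes "prob_space M"
    and "a < b"
    and "n \<ge> 1"
    and "\<And>D. real_distribution D \<Longrightarrow> measure D {a..b} = 1 \<Longrightarrow>
           \<exists>X\<in>rv_in M a b. distr M borel X = D"
  shows
    "(\<forall>X\<in>rv_in M a b. \<forall>Y\<in>rv_in M a b.
        (sd_on M a b n X Y \<longleftrightarrow> prefers M (utilities n {a..b}) X Y) \<and>
        (prefers M (utilities n {a..b}) X Y \<longleftrightarrow> prefers M (closed_utilities n {a..b}) X Y)) \<and>
     (\<forall>X\<in>rv_in M a b. \<forall>Y\<in>rv_in M a b.
        (sd M n X Y \<longleftrightarrow> prefers M (utilities n UNIV) X Y) \<and>
        (prefers M (utilities n UNIV) X Y \<longleftrightarrow> prefers M (closed_utilities n UNIV) X Y)) \<and>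
     (\<forall>X\<in>rv_in M a b. \<forall>Y\<in>rv_in M a b. sd_on M a b n X Y \<longrightarrow> sd M n X Y) \<and>
     ((\<forall>X\<in>rv_in M a b. \<forall>Y\<in>rv_in M a b. sd M n X Y \<longrightarrow> sd_on M a b n X Y) \<longleftrightarrow> n \<le> 3)"
proof -
  interpret prob_space M by (rule assms(1))
  note ab = assms(2)
  obtain m where n: "n = Suc m" using assms(3) by (cases n) auto
  have A: "sd_on M a b n X Y \<longleftrightarrow> prefers M (utilities n {a..b}) X Y"
    and B: "sd M n X Y \<longleftrightarrow> prefers M (utilities n UNIV) X Y"
    and A': "prefers M (utilities n {a..b}) X Y \<longleftrightarrow> prefers M (closed_utilities n {a..b}) X Y"
    and B': "prefers M (utilities n UNIV) X Y \<longleftrightarrow> prefers M (closed_utilities n UNIV) X Y"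
    if "X \<in> rv_in M a b" "Y \<in> rv_in M a b" for X Y
    using sd_on_iff_prefers[OF that ab, of m] sd_iff_prefers[OF that ab, of m]
      prefers_closed_utilities_iff[OF that ab assms(3), of "{a..b}"]
      prefers_closed_utilities_iff[OF that ab assms(3), of UNIV] by (simp_all add: n)
  have C: "sd M n X Y" if "X \<in> rv_in M a b" "Y \<in> rv_in M a b" "sd_on M a b n X Y" for X Y
    using that A[OF that(1,2)] B[OF that(1,2)] prefers_subset[OF utilities_restrict[OF ab]] by metis
  have D: "n \<le> 3" if imp: "\<forall>X\<in>rv_in M a b. \<forall>Y\<in>rv_in M a b. sd M n X Y \<longrightarrow> sd_on M a b n X Y"
  proof (rule ccontr)
    assume "\<not> n \<le> 3"
    then have n4: "Suc 3 \<le> n" and m: "2 \<le> m" using n by simp_all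
    obtain X Y where X: "X \<in> rv_in M a b" and Y: "Y \<in> rv_in M a b" and sd: "sd M 4 X Y"
      and less: "expectation (\<lambda>\<omega>. (b - Y \<omega>)\<^sup>2) < expectation (\<lambda>\<omega>. (b - X \<omega>)\<^sup>2)"
      using ex_sd_4_not_second_moment_ordered[OF assms(4) ab] by blast
    have "sd M n X Y" using sd by (intro sd_higher_order[OF X Y ab n4]) simp
    then have "sd_on M a b (Suc m) X Y" using imp X Y n by blast
    then show False using less m unfolding sd_on_iff[OF X Y] by (meson not_less)
  qed
  have D': "sd_on M a b n X Y" if "n \<le> 3" "X \<in> rv_in M a b" "Y \<in> rv_in M a b" "sd M n X Y" for X Y
    using sd_imp_sd_on[OF that(2,3), of m] that n by simp
  show ?thesis
  proof (intro conjI ballI impI)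
    show "(\<forall>X\<in>rv_in M a b. \<forall>Y\<in>rv_in M a b. sd M n X Y \<longrightarrow> sd_on M a b n X Y) \<longleftrightarrow> n \<le> 3"
      using D D' by blast
  qed (rule A A' B B' C; assumption)+
qed

end
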